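(* The triple $\bigl((\mathrm{S}(E),\oplus_{\mathrm{S}(E)}),(\mathrm{M}(E),\oplus_{\mathrm{M}(E)}),h\bigr)$ characterizes $E$ up to isomorphism within the class of all TRT-effect algebras. That is: let $E$ and $F$ be TRT-effect algebras with associated triples $(\mathrm{S}(E),\mathrm{M}(E),h_E)$ and $(\mathrm{S}(F),\mathrm{M}(F),h_F)$. Then $E$ and $F$ are isomorphic as effect algebras if and only if their triples are isomorphic, i.e. if and only if there exist an isomorphism of effect algebras $\sigma:\mathrm{S}(E)\to \mathrm{S}(F)$ and an isomorphism of generalized effect algebras $\mu:\mathrm{M}(E)\to \mathrm{M}(F)$ such that $\mu(h_E(s))=h_F(\sigma(s))$ for every $s\in \mathrm{S}(E)$.
   Context: **Effect algebras.** An effect algebra is a partial algebra $(E;\oplus,0,1)$ with two distinct elements $0,1$ and a partial binary operation $\oplus$ such that for all $x,y,z\in E$: $x\oplus y=y\oplus x$ if $x\oplus y$ is defined; $(x\oplus y)\oplus z=x\oplus(y\oplus z)$ if one side is defined; for every $x$ there is a unique $y$ with $x\oplus y=1$ (written $y=x'$); if $1\oplus x$ is defined then $x=0$. A generalized effect algebra $(E;\oplus,0)$ has a partial binary operation $\oplus$ with: $x\oplus y=y\oplus x$ if one side is defined; $(x\oplus y)\oplus z=x\oplus(y\oplus z)$ if one side is defined; $x\oplus y=x\oplus z$ implies $y=z$; $x\oplus y=0$ implies $x=y=0$; $x\oplus 0=x$ for all $x$. In both cases put $x\le y$ and $y\ominus x=z$ iff $x\oplus z$ is defined and $x\oplus z=y$;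 $\le$ is a partial order, and $\wedge,\vee$ refer to meets and joins in this order. A sub-effect algebra of $E$ is a subset $Q$ with $1\in Q$ such that whenever $x\oplus y=z$ in $E$ and two of $x,y,z$ lie in $Q$, then all three do; it is an effect algebra with the inherited operation. A morphism of effect algebras preserves the unit and orthosums (if $x\oplus y$ is defined then $f(x)\oplus f(y)$ is defined and equals $f(x\oplus y)$); an isomorphism is a bijective morphism whose inverse is a morphism. An isomorphism of generalized effect algebras is a bijection preserving $0$ and such that $x\oplus y$ is defined iff $f(x)\oplus f(y)$ is, in which case $f(x\oplus y)=f(x)\oplus f(y)$. **Homogeneity and blocks.** $E$ has the Riesz decomposition property (RDP) if $u\le v_1\oplus v_2$ implies $u=u_1\oplus u_2$ for some $u_1\le v_1$, $u_2\le v_2$. $E$ is homogeneous if $u\le v_1\oplus v_2\le u'$ implies $u=u_1\oplus u_2$ for some $u_1\le v_1$, $u_2\le v_2$. A block of a homogeneous effect algebra $E$ is a maximal sub-effect algebra of $E$ with the RDP. **Sharp and meager elements.** $x\in E$ is sharp if $x\wedge x'=0$; $\mathrm{S}(E)$ is the set of sharp elements. $E$ is sharply dominating if for every $x\in E$ there is a smallest sharp element $\widehat{x}$ with $x\le\widehat{x}$; equivalently, for every $x$ there is a largest sharp element $\widetilde{x}$ with $\widetilde{x}\le x$. In a sharply dominating $E$, $\mathrm{S}(E)$ is a sub-effect algebra, with operation $\oplus_{\mathrm{S}(E)}$ the restriction of $\oplus$. The set of meager elements is $\mathrm{M}(E)=\{x\in E\mid \text{if } v\in \mathrm{S}(E)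 \text{ and } v\le x \text{ then } v=0\}$; it is a generalized effect algebra under $\oplus_{\mathrm{M}(E)}$, where $x\oplus_{\mathrm{M}(E)}y$ is defined iff $x\oplus y$ is defined in $E$ and $x\oplus y\in \mathrm{M}(E)$, in which case $x\oplus_{\mathrm{M}(E)}y=x\oplus y$; $\ominus_{\mathrm{M}(E)}$ is the corresponding difference. The map $h=h_E:\mathrm{S}(E)\to 2^{\mathrm{M}(E)}$ is $h(s)=\{x\in \mathrm{M}(E)\mid x\le s\}$. **TRT-effect algebras.** A TRT-effect algebra is a homogeneous sharply dominating effect algebra $E$ such that (1) for every block $B$ of $E$, $x\in B$ implies $[\widetilde{x},x]=\{z\in E\mid\widetilde{x}\le z\le x\}\subseteq B$; and (2) for every $x\in \mathrm{M}(E)$, the element $y=\widehat{x}\ominus x$ is the only element satisfying all of the following (assertions that an expression exists include the existence of its subexpressions and meets): (i) $y\in \mathrm{M}(E)$ and $\widehat{y}=\widehat{x}$; (ii) $x\oplus_{\mathrm{M}(E)}(y\ominus_{\mathrm{M}(E)}(x\wedge y))$ exists and belongs to $h(\widehat{x})$; (iii) for all $z\in h(\widehat{x})$: $z\oplus_{\mathrm{M}(E)}x$ exists and belongs to $h(\widehat{x})$ if and only if $z\le y$ and $\widehat{y\ominus_{\mathrm{M}(E)}z}=\widehat{x}$. *)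

theory Defs
  imports Main
begin

text \<open>
  A partial operation on a carrier set is an option-valued function: \<open>osum A x y = Some z\<close> means
  that the orthosum of \<open>x\<close> and \<open>y\<close> is defined and equals \<open>z\<close>.  Equality of
  option values therefore says that if one side is defined then so is the other, and both agree.
  The axiom \<open>osum_closed\<close> below makes the domain of the operation a subset of the square of the
  carrier, so that arguments outside the carrier never have an orthosum.
\<close>

record 'a gealg =
  carrier :: "'a set"
  osum :: "'a \<Rightarrow> 'a \<Rightarrow> 'a option"
  ozero :: 'a

record 'a ealg = "'a gealg" +
  ounit :: 'a

locale generalized_effect_algebra =
  fixes A :: "('a, 'm) gealg_scheme"
  assumes osum_closed: "osum A x y = Some z \<Longrightarrow> x \<in> carrier A \<and> y \<in> carrier A \<and> z \<in> carrier A"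
    and zero_closed: "ozero A \<in> carrier A"
    and commute: "osum A x y = osum A y x"
    and assoc: "Option.bind (osum A x y) (\<lambda>u. osum A u z) = Option.bind (osum A y z) (osum A x)"
    and cancel: "osum A x y = Some w \<Longrightarrow> osum A x z = Some w \<Longrightarrow> y = z"
    and positive: "osum A x y = Some (ozero A) \<Longrightarrow> x = ozero A \<and> y = ozero A"
    and osum_zero: "x \<in> carrier A \<Longrightarrow> osum A x (ozero A) = Some x"

locale effect_algebra =
  fixes E :: "'a ealg"
  assumes osum_closed: "osum E x y = Some z \<Longrightarrow> x \<in> carrier E \<and> y \<in> carrier E \<and> z \<in> carrier E"
    and zero_closed: "ozero E \<in> carrier E"
    and unit_closed: "ounit E \<in> carrier E"
    and zero_neq_unit: "ozero E \<noteq> ounit E"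
    and commute: "osum E x y = osum E y x"
    and assoc: "Option.bind (osum E x y) (\<lambda>u. osum E u z) = Option.bind (osum E y z) (osum E x)"
    and ex1_compl: "x \<in> carrier E \<Longrightarrow> \<exists>!y. osum E x y = Some (ounit E)"
    and unit_osum: "osum E (ounit E) x \<noteq> None \<Longrightarrow> x = ozero E"

definition ole :: "('a, 'm) gealg_scheme \<Rightarrow> 'a \<Rightarrow> 'a \<Rightarrow> bool" where
  "ole A x y \<longleftrightarrow> (\<exists>z. osum A x z = Some y)"

text \<open>\<open>is_odiff A y x z\<close>: the difference of \<open>y\<close> and \<open>x\<close> exists and equals \<open>z\<close>.\<close>

definition is_odiff :: "('a, 'm) gealg_scheme \<Rightarrow> 'a \<Rightarrow> 'a \<Rightarrow> 'a \<Rightarrow> bool" where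
  "is_odiff A y x z \<longleftrightarrow> osum A x z = Some y"

text \<open>\<open>is_omeet A x y m\<close>: the meet of \<open>x\<close> and \<open>y\<close> exists and equals \<open>m\<close>.\<close>

definition is_omeet :: "('a, 'm) gealg_scheme \<Rightarrow> 'a \<Rightarrow> 'a \<Rightarrow> 'a \<Rightarrow> bool" where
  "is_omeet A x y m \<longleftrightarrow> ole A m x \<and> ole A m y \<and> (\<forall>w. ole A w x \<and> ole A w y \<longrightarrow> ole A w m)"

definition ocompl :: "'a ealg \<Rightarrow> 'a \<Rightarrow> 'a" where
  "ocompl E x = (THE y. osum E x y = Some (ounit E))"

text \<open>The sum is kept only if the arguments and the result lie in \<open>Q\<close>.\<close>

definition osum_on :: "('a, 'm) gealg_scheme \<Rightarrow> 'a set \<Rightarrow> 'a \<Rightarrow> 'a \<Rightarrow> 'a option" where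
  "osum_on A Q x y =
     (case osum A x y of None \<Rightarrow> None
      | Some z \<Rightarrow> if x \<in> Q \<and> y \<in> Q \<and> z \<in> Q then Some z else None)"

definition sub_effect_algebra :: "'a ealg \<Rightarrow> 'a set \<Rightarrow> bool" where
  "sub_effect_algebra E Q \<longleftrightarrow>
     Q \<subseteq> carrier E \<and> ounit E \<in> Q \<and>
     (\<forall>x y z. osum E x y = Some z \<longrightarrow>
        (x \<in> Q \<and> y \<in> Q \<longrightarrow> z \<in> Q) \<and> (x \<in> Q \<and> z \<in> Q \<longrightarrow> y \<in> Q) \<and> (y \<in> Q \<and> z \<in> Q \<longrightarrow> x \<in> Q))"

definition sub_ealg :: "'a ealg \<Rightarrow> 'a set \<Rightarrow> 'a ealg" where
  "sub_ealg E Q = \<lparr>carrier = Q, osum = osum_on E Q, ozero = ozero E, ounit = ounit E\<rparr>"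

definition ea_morphism :: "'a ealg \<Rightarrow> 'b ealg \<Rightarrow> ('a \<Rightarrow> 'b) \<Rightarrow> bool" where
  "ea_morphism E F f \<longleftrightarrow>
     f ` carrier E \<subseteq> carrier F \<and> f (ounit E) = ounit F \<and>
     (\<forall>x y z. osum E x y = Some z \<longrightarrow> osum F (f x) (f y) = Some (f z))"

definition ea_isomorphism :: "'a ealg \<Rightarrow> 'b ealg \<Rightarrow> ('a \<Rightarrow> 'b) \<Rightarrow> bool" where
  "ea_isomorphism E F f \<longleftrightarrow>
     ea_morphism E F f \<and> bij_betw f (carrier E) (carrier F) \<and>
     ea_morphism F E (inv_into (carrier E) f)"

definition gea_isomorphism ::
    "('a, 'm) gealg_scheme \<Rightarrow> ('b, 'n) gealg_scheme \<Rightarrow> ('a \<Rightarrow> 'b) \<Rightarrow> bool" where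
  "gea_isomorphism A B f \<longleftrightarrow>
     bij_betw f (carrier A) (carrier B) \<and> f (ozero A) = ozero B \<and>
     (\<forall>x\<in>carrier A. \<forall>y\<in>carrier A. osum B (f x) (f y) = map_option f (osum A x y))"

definition riesz_decomposition :: "'a ealg \<Rightarrow> bool" where
  "riesz_decomposition E \<longleftrightarrow>
     (\<forall>u v1 v2 v. osum E v1 v2 = Some v \<and> ole E u v \<longrightarrow>
        (\<exists>u1 u2. ole E u1 v1 \<and> ole E u2 v2 \<and> osum E u1 u2 = Some u))"

definition homogeneous :: "'a ealg \<Rightarrow> bool" where
  "homogeneous E \<longleftrightarrow>
     (\<forall>u v1 v2 v. osum E v1 v2 = Some v \<and> ole E u v \<and> ole E v (ocompl E u) \<longrightarrow>
        (\<exists>u1 u2. ole E u1 v1 \<and> ole E u2 v2 \<and> osum E u1 u2 = Some u))"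

definition block :: "'a ealg \<Rightarrow> 'a set \<Rightarrow> bool" where
  "block E B \<longleftrightarrow>
     sub_effect_algebra E B \<and> riesz_decomposition (sub_ealg E B) \<and>
     (\<forall>C. sub_effect_algebra E C \<and> riesz_decomposition (sub_ealg E C) \<and> B \<subseteq> C \<longrightarrow> C = B)"

definition sharp_elems :: "'a ealg \<Rightarrow> 'a set" where
  "sharp_elems E = {x \<in> carrier E. is_omeet E x (ocompl E x) (ozero E)}"

definition meager_elems :: "'a ealg \<Rightarrow> 'a set" where
  "meager_elems E = {x \<in> carrier E. \<forall>v\<in>sharp_elems E. ole E v x \<longrightarrow> v = ozero E}"

definition is_sharp_cover :: "'a ealg \<Rightarrow> 'a \<Rightarrow> 'a \<Rightarrow> bool" where
  "is_sharp_cover E x s \<longleftrightarrow>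
     s \<in> sharp_elems E \<and> ole E x s \<and> (\<forall>t\<in>sharp_elems E. ole E x t \<longrightarrow> ole E s t)"

definition is_sharp_kernel :: "'a ealg \<Rightarrow> 'a \<Rightarrow> 'a \<Rightarrow> bool" where
  "is_sharp_kernel E x s \<longleftrightarrow>
     s \<in> sharp_elems E \<and> ole E s x \<and> (\<forall>t\<in>sharp_elems E. ole E t x \<longrightarrow> ole E t s)"

definition sharply_dominating :: "'a ealg \<Rightarrow> bool" where
  "sharply_dominating E \<longleftrightarrow> (\<forall>x\<in>carrier E. \<exists>s. is_sharp_cover E x s)"

definition sharp_cover :: "'a ealg \<Rightarrow> 'a \<Rightarrow> 'a" where
  "sharp_cover E x = (THE s. is_sharp_cover E x s)"

definition sharp_kernel :: "'a ealg \<Rightarrow> 'a \<Rightarrow> 'a" where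
  "sharp_kernel E x = (THE s. is_sharp_kernel E x s)"

definition sharp_alg :: "'a ealg \<Rightarrow> 'a ealg" where
  "sharp_alg E = sub_ealg E (sharp_elems E)"

definition meager_alg :: "'a ealg \<Rightarrow> 'a gealg" where
  "meager_alg E =
     \<lparr>carrier = meager_elems E, osum = osum_on E (meager_elems E), ozero = ozero E\<rparr>"

definition meager_below :: "'a ealg \<Rightarrow> 'a \<Rightarrow> 'a set" where
  "meager_below E s = {x \<in> meager_elems E. ole E x s}"

definition trt_condition :: "'a ealg \<Rightarrow> 'a \<Rightarrow> 'a \<Rightarrow> bool" where
  "trt_condition E x y \<longleftrightarrow>
     (y \<in> meager_elems E \<and> sharp_cover E y = sharp_cover E x) \<and>
     (\<exists>m d w. is_omeet E x y m \<and> is_odiff (meager_alg E) y m d \<and>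
        osum (meager_alg E) x d = Some w \<and> w \<in> meager_below E (sharp_cover E x)) \<and>
     (\<forall>z\<in>meager_below E (sharp_cover E x).
        (\<exists>w. osum (meager_alg E) z x = Some w \<and> w \<in> meager_below E (sharp_cover E x)) \<longleftrightarrow>
        (ole E z y \<and> (\<exists>d. is_odiff (meager_alg E) y z d \<and> sharp_cover E d = sharp_cover E x)))"

locale trt_effect_algebra = effect_algebra +
  assumes homogeneous: "homogeneous E"
    and sharply_dominating: "sharply_dominating E"
    and block_interval: "block E B \<Longrightarrow> x \<in> B \<Longrightarrow>
      {z \<in> carrier E. ole E (sharp_kernel E x) z \<and> ole E z x} \<subseteq> B"
    and trt: "x \<in> meager_elems E \<Longrightarrow>
      \<exists>y. is_odiff E (sharp_cover E x) x y \<and> trt_condition E x y \<and>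
          (\<forall>w\<in>carrier E. trt_condition E x w \<longrightarrow> w = y)"

text \<open>
  The following facts show that the elements chosen by \<open>THE\<close> above exist and are unique, and that
  the meager elements form a generalized effect algebra.
\<close>

context effect_algebra
begin

lemma assocD1:
  assumes "osum E x y = Some u" "osum E u z = Some w"
  obtains v where "osum E y z = Some v" "osum E x v = Some w"
  using assoc[of x y z] assms by (cases "osum E y z") auto

lemma assocD2:
  assumes "osum E y z = Some v" "osum E x v = Some w"
  obtains u where "osum E x y = Some u" "osum E u z = Some w"
  using assoc[of x y z] assms by (cases "osum E x y") auto

lemma osum_ocompl: "x \<in> carrier E \<Longrightarrow> osum E x (ocompl E x) = Some (ounit E)"
  unfolding ocompl_def by (rule theI') (rule ex1_compl)

lemma compl_unique:
  "osum E x y = Some (ounit E) \<Longrightarrow> osum E x z = Some (ounit E) \<Longrightarrow> y = z"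
  using ex1_compl osum_closed by blast

lemma unit_osum_zero: "osum E (ounit E) (ozero E) = Some (ounit E)"
  using ex1_compl[OF unit_closed] unit_osum by (metis option.distinct(1))

lemma osum_zero:
  assumes "x \<in> carrier E"
  shows "osum E x (ozero E) = Some x"
proof -
  have c: "osum E (ocompl E x) x = Some (ounit E)"
    using osum_ocompl[OF assms] commute by simp
  obtain v where v: "osum E x (ozero E) = Some v" "osum E (ocompl E x) v = Some (ounit E)"
    using assocD1[OF c unit_osum_zero] .
  then show ?thesis using compl_unique c by blast
qed

lemma cancel:
  assumes "osum E x y = Some w" "osum E x z = Some w"
  shows "y = z"
proof -
  have w: "osum E w (ocompl E w) = Some (ounit E)"
    using osum_ocompl osum_closed assms(1) by blast
  have yx: "osum E y x = Some w" and zx: "osum E z x = Some w"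
    using assms commute by simp_all
  obtain v where v: "osum E x (ocompl E w) = Some v" "osum E y v = Some (ounit E)"
    using assocD1[OF yx w] .
  have "osum E z v = Some (ounit E)"
    using assocD1[OF zx w] v(1) by auto
  then show ?thesis using v(2) compl_unique commute by metis
qed

lemma positive_aux:
  assumes "osum E x y = Some (ozero E)"
  shows "y = ozero E"
proof -
  have "osum E (ozero E) (ounit E) = Some (ounit E)"
    using unit_osum_zero commute by simp
  then obtain v where "osum E y (ounit E) = Some v"
    using assocD1[OF assms] by blast
  then show ?thesis using unit_osum commute by (metis option.distinct(1))
qed

lemma is_generalized_effect_algebra: "generalized_effect_algebra E"
proof
  show "osum E x y = Some (ozero E) \<Longrightarrow> x = ozero E \<and> y = ozero E" for x y
    using positive_aux commute by metis
qed (fact osum_closed zero_closed commute assoc cancel osum_zero)+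

lemma ole_carrier: "ole E x y \<Longrightarrow> x \<in> carrier E \<and> y \<in> carrier E"
  unfolding ole_def using osum_closed by auto

lemma ole_refl: "x \<in> carrier E \<Longrightarrow> ole E x x"
  using osum_zero ole_def by metis

lemma ole_trans: "ole E x y \<Longrightarrow> ole E y z \<Longrightarrow> ole E x z"
  unfolding ole_def using assocD1 by metis

lemma ole_antisym:
  assumes "ole E x y" "ole E y x"
  shows "x = y"
proof -
  obtain a b where a: "osum E x a = Some y" and b: "osum E y b = Some x"
    using assms ole_def by metis
  obtain v where v: "osum E a b = Some v" "osum E x v = Some x"
    using assocD1[OF a b] .
  have x: "x \<in> carrier E" using osum_closed a by blast
  have "v = ozero E" using cancel v(2) osum_zero[OF x] by blast
  then have "a = ozero E"
    using v(1) positive_aux commute by metis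
  then show ?thesis using a osum_zero[OF x] by simp
qed

lemma zero_ole: "x \<in> carrier E \<Longrightarrow> ole E (ozero E) x"
  using osum_zero commute ole_def by metis

lemma sharp_cover_eqI: "is_sharp_cover E x s \<Longrightarrow> sharp_cover E x = s"
  unfolding sharp_cover_def by (rule the_equality) (auto simp: is_sharp_cover_def intro: ole_antisym)

lemma sharp_kernel_eqI: "is_sharp_kernel E x s \<Longrightarrow> sharp_kernel E x = s"
  unfolding sharp_kernel_def by (rule the_equality) (auto simp: is_sharp_kernel_def intro: ole_antisym)

lemma meager_down: "x \<in> meager_elems E \<Longrightarrow> ole E y x \<Longrightarrow> y \<in> meager_elems E"
  unfolding meager_elems_def using ole_trans ole_carrier by auto

lemma osum_on_Some:
  "osum_on E Q x y = Some z \<longleftrightarrow> osum E x y = Some z \<and> x \<in> Q \<and> y \<in> Q \<and> z \<in> Q"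
  unfolding osum_on_def by (auto split: option.splits)

lemma ocompl_ocompl: "x \<in> carrier E \<Longrightarrow> ocompl E (ocompl E x) = x"
  using osum_ocompl osum_closed compl_unique commute by metis

lemma ole_ocompl:
  assumes "ole E x y"
  shows "ole E (ocompl E y) (ocompl E x)"
proof -
  obtain a where a: "osum E x a = Some y" using assms ole_def by metis
  have "osum E y (ocompl E y) = Some (ounit E)" using a osum_closed osum_ocompl by blast
  then obtain v where v: "osum E a (ocompl E y) = Some v" "osum E x v = Some (ounit E)"
    using assocD1[OF a] by blast
  then have "v = ocompl E x" using compl_unique osum_ocompl osum_closed by blast
  then show ?thesis using v(1) commute ole_def by metis
qed

lemma sharp_ocompl:
  assumes "x \<in> sharp_elems E"
  shows "ocompl E x \<in> sharp_elems E"
proof -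
  have x: "x \<in> carrier E" and m: "is_omeet E x (ocompl E x) (ozero E)"
    using assms by (auto simp: sharp_elems_def)
  have "ocompl E x \<in> carrier E" using osum_ocompl[OF x] osum_closed by blast
  then show ?thesis using m ocompl_ocompl[OF x] by (auto simp: sharp_elems_def is_omeet_def)
qed

lemma sharp_kernel_exists:
  assumes sd: "sharply_dominating E" and x: "x \<in> carrier E"
  shows "is_sharp_kernel E x (sharp_kernel E x)"
proof -
  have x': "ocompl E x \<in> carrier E" using osum_ocompl[OF x] osum_closed by blast
  then obtain s where s: "s \<in> sharp_elems E" "ole E (ocompl E x) s"
      "\<And>t. t \<in> sharp_elems E \<Longrightarrow> ole E (ocompl E x) t \<Longrightarrow> ole E s t"
    using sd unfolding sharply_dominating_def is_sharp_cover_def by metis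
  have "ole E t (ocompl E s)" if t: "t \<in> sharp_elems E" "ole E t x" for t
  proof -
    have "t \<in> carrier E" using t(1) by (simp add: sharp_elems_def)
    then show ?thesis using ole_ocompl[OF s(3)[OF sharp_ocompl[OF t(1)] ole_ocompl[OF t(2)]]]
      by (simp add: ocompl_ocompl)
  qed
  then have "is_sharp_kernel E x (ocompl E s)"
    using sharp_ocompl[OF s(1)] ole_ocompl[OF s(2)] ocompl_ocompl[OF x]
    by (simp add: is_sharp_kernel_def)
  then show ?thesis using sharp_kernel_eqI by simp
qed

lemma meager_alg_generalized_effect_algebra: "generalized_effect_algebra (meager_alg E)"
proof -
  let ?M = "meager_elems E"
  have up: "z \<in> ?M \<Longrightarrow> osum E x y = Some z \<Longrightarrow> x \<in> ?M \<and> y \<in> ?M" for x y z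
    using meager_down commute ole_def by metis
  have zM: "ozero E \<in> ?M"
    using zero_closed zero_ole ole_antisym by (auto simp: meager_elems_def sharp_elems_def)
  have onM: "osum_on E ?M x y = Some z \<longleftrightarrow> osum E x y = Some z \<and> z \<in> ?M" for x y z
    using osum_on_Some up by metis
  have comm: "osum_on E ?M x y = osum_on E ?M y x" for x y
    unfolding osum_on_def using commute[of x y] by (auto split: option.splits)
  have ass: "Option.bind (osum_on E ?M x y) (\<lambda>u. osum_on E ?M u z)
      = Option.bind (osum_on E ?M y z) (osum_on E ?M x)" (is "?l = ?r") for x y z
  proof -
    have "?l = Some w \<longleftrightarrow> ?r = Some w" for w
      proof
      assume "?l = Some w"
      then obtain u where "osum E x y = Some u" "osum E u z = Some w" and w: "w \<in> ?M"
        unfolding bind_eq_Some_conv onM by blast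
      then obtain v where v: "osum E y z = Some v" "osum E x v = Some w"
        using assocD1 by blast
      then show "?r = Some w"
        unfolding bind_eq_Some_conv onM using w up[OF w v(2)] by blast
    next
      assume "?r = Some w"
      then obtain v where "osum E y z = Some v" "osum E x v = Some w" and w: "w \<in> ?M"
        unfolding bind_eq_Some_conv onM by blast
      then obtain u where u: "osum E x y = Some u" "osum E u z = Some w"
        using assocD2 by blast
      then show "?l = Some w"
        unfolding bind_eq_Some_conv onM using w up[OF w u(2)] by blast
    qed
    then show ?thesis by (metis not_None_eq)
  qed
  show ?thesis
    unfolding meager_alg_def
  proof (unfold_locales, simp_all only: gealg.simps)
    show "osum_on E ?M x y = Some z \<Longrightarrow> x \<in> ?M \<and> y \<in> ?M \<and> z \<in> ?M" for x y z
      by (simp add: osum_on_Some)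
    show "osum_on E ?M x y = Some w \<Longrightarrow> osum_on E ?M x z = Some w \<Longrightarrow> y = z" for x y z w
      using onM cancel by blast
    show "osum_on E ?M x y = Some (ozero E) \<Longrightarrow> x = ozero E \<and> y = ozero E" for x y
      using onM positive_aux commute by metis
    show "x \<in> ?M \<Longrightarrow> osum_on E ?M x (ozero E) = Some x" for x
      using onM osum_zero by (simp add: meager_elems_def)
  qed (fact zM comm ass)+
qed

end

end

(*
Every element of a sharply dominating homogeneous effect algebra is uniquely s + m with s sharp and
m meager, so an isomorphism of triples has to be extended by s + m |-> sigma(s) + mu(m). The only
question is whether sums of meager elements are respected. If m + n = v + k with v sharp and k meager,
then m and n lie in a common block (Jenca), which also contains v, the sharp kernel of m + n; the Riesz
decomposition property splits v = v1 + v2 with v1 <= m, v2 <= n. Here v is the sharp cover of v1, so v2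
is the element characterised in the triple by condition (2), and mu maps v1, v2 to a splitting of
sigma(v). Blocks are obtained from subsets X that are maximal such that every finite subset of X is
refined by a decomposition of the unit into elements of X: homogeneity forces such an X to contain
all z with z <= x, x' for some x in X, and these are the pieces needed to refine decompositions.
*)

theory Submission
  imports Defs "HOL-Library.Multiset"
begin

section \<open>Sharp elements\<close>

text \<open>Two obstacles shape the argument. Homogeneity splits \<open>u\<close> along
  \<open>v1 + v2\<close> only if the sum also lies below the complement of \<open>u\<close>, so an
  arbitrary element cannot be cut along a decomposition. Decompositions of the unit supply the
  missing inequality: subwords with no occurrence of a letter in common are orthogonal, so the part
  of one word outside another can be cut along it. The remainders of such cuts must again be
  admissible letters, which is why a closure under certain differences precedes the use of
  maximality. The second obstacle is that \<mu> respects only sums that stay meager and is tied to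
  \<sigma> only through \<open>h\<close>; a sharp sum of two meager elements is invisible to both
  maps. Such a sum is recovered from the uniqueness asserted in \<open>F\<close>, which determines
  the image of one summand from that of the other.\<close>

context effect_algebra
begin

lemma ocompl_closed: "x \<in> carrier E \<Longrightarrow> ocompl E x \<in> carrier E"
  using osum_ocompl osum_closed by blast

lemma ole_osum:
  assumes "osum E x y = Some z"
  shows "ole E x z" "ole E y z"
  using assms commute ole_def by metis+

lemma osum_ole_ocompl:
  assumes "osum E x y = Some z"
  shows "ole E x (ocompl E y)"
proof -
  have c: "osum E y x = Some z" using assms commute by simp
  have "osum E z (ocompl E z) = Some (ounit E)"
    using osum_ocompl osum_closed[OF assms] by blast
  then obtain v where v: "osum E x (ocompl E z) = Some v" "osum E y v = Some (ounit E)"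
    using assocD1[OF c] by blast
  then have "v = ocompl E y" using compl_unique osum_ocompl osum_closed by blast
  then show ?thesis using v(1) ole_def by metis
qed

lemma ole_ocompl_osum:
  assumes "ole E x (ocompl E y)" "y \<in> carrier E"
  obtains z where "osum E x y = Some z"
proof -
  obtain d where "osum E x d = Some (ocompl E y)" using assms(1) ole_def by metis
  then have d: "osum E d x = Some (ocompl E y)" using commute by metis
  have "osum E (ocompl E y) y = Some (ounit E)" using osum_ocompl[OF assms(2)] commute by metis
  then show ?thesis using assocD1[OF d] that by blast
qed

lemma ole_ocompl_sym:
  assumes "ole E x (ocompl E y)" "y \<in> carrier E"
  shows "ole E y (ocompl E x)"
  using ole_ocompl_osum[OF assms] osum_ole_ocompl commute by metis

lemma osum_mono_left:
  assumes "ole E x u" "osum E u y = Some w"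
  obtains z where "osum E x y = Some z" "ole E z w"
proof -
  obtain d where "osum E x d = Some u" using assms(1) ole_def by metis
  then have d: "osum E d x = Some u" using commute by metis
  show ?thesis using assocD1[OF d assms(2)] that ole_osum(2) by metis
qed

text \<open>The new partial sums are not assumed to exist; their definedness is part of the
  conclusion.\<close>

lemma osum_interchange:
  assumes "osum E a b = Some u" "osum E c d = Some v" "osum E u v = Some w"
  obtains p q where "osum E a c = Some p" "osum E b d = Some q" "osum E p q = Some w"
proof -
  obtain r where r: "osum E b v = Some r" "osum E a r = Some w"
    using assocD1[OF assms(1,3)] .
  obtain k where k: "osum E b c = Some k" "osum E k d = Some r"
    using assocD2[OF assms(2) r(1)] .
  have cb: "osum E c b = Some k" using k(1) commute by metis
  obtain q where q: "osum E b d = Some q" "osum E c q = Some r"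
    using assocD1[OF cb k(2)] .
  obtain p where "osum E a c = Some p" "osum E p q = Some w"
    using assocD2[OF q(2) r(2)] .
  then show ?thesis using that q(1) by blast
qed

lemma ole_zero: "ole E x (ozero E) \<Longrightarrow> x = ozero E"
  using zero_ole ole_antisym ole_carrier by blast

lemma sharp_closed: "s \<in> sharp_elems E \<Longrightarrow> s \<in> carrier E"
  by (simp add: sharp_elems_def)

lemma meager_closed: "m \<in> meager_elems E \<Longrightarrow> m \<in> carrier E"
  by (simp add: meager_elems_def)

lemma sharp_iff:
  "s \<in> sharp_elems E \<longleftrightarrow>
    s \<in> carrier E \<and> (\<forall>u. ole E u s \<and> ole E u (ocompl E s) \<longrightarrow> u = ozero E)"
  unfolding sharp_elems_def is_omeet_def
  using zero_ole ocompl_closed ole_zero ole_refl[OF zero_closed] by blast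

lemma unit_sharp: "ounit E \<in> sharp_elems E"
proof -
  have "ocompl E (ounit E) = ozero E"
    using compl_unique osum_ocompl unit_osum_zero unit_closed by blast
  then show ?thesis using unit_closed ole_zero sharp_iff by auto
qed

text \<open>An element \<open>u\<close> below \<open>r\<close> and its complement satisfies the
  hypothesis of homogeneity, so it splits along \<open>s\<close> and \<open>t\<close>; each piece
  then lies below a sharp element and its complement.\<close>

lemma sharp_osum:
  assumes hom: "homogeneous E" and s: "s \<in> sharp_elems E" and t: "t \<in> sharp_elems E"
    and r: "osum E s t = Some r"
  shows "r \<in> sharp_elems E"
  unfolding sharp_iff
proof (intro conjI allI impI)
  show rc: "r \<in> carrier E" using osum_closed[OF r] by blast
  fix u assume u: "ole E u r \<and> ole E u (ocompl E r)"
  then have "ole E r (ocompl E u)" using ole_ocompl_sym[OF _ rc] by blast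
  then obtain u1 u2 where u12: "ole E u1 s" "ole E u2 t" "osum E u1 u2 = Some u"
    using hom u r unfolding homogeneous_def by blast
  have "ole E u1 (ocompl E s)" "ole E u2 (ocompl E t)"
    using u u12(3) ole_osum r ole_ocompl ole_trans by metis+
  then have "u1 = ozero E" "u2 = ozero E" using s t u12 unfolding sharp_iff by blast+
  then show "u = ozero E" using u12(3) osum_zero[OF zero_closed] by simp
qed

text \<open>Complementation turns the difference into a sum: the complement of \<open>t\<close> is
  \<open>s\<close> plus the complement of \<open>r\<close>.\<close>

lemma sharp_diff:
  assumes hom: "homogeneous E" and s: "s \<in> sharp_elems E" and r: "r \<in> sharp_elems E"
    and sum: "osum E s t = Some r"
  shows "t \<in> sharp_elems E"
proof -
  have c: "osum E t s = Some r" using sum commute by simp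
  have "osum E r (ocompl E r) = Some (ounit E)" using osum_ocompl sharp_closed[OF r] by blast
  then obtain v where v: "osum E s (ocompl E r) = Some v" "osum E t v = Some (ounit E)"
    using assocD1[OF c] by blast
  have "v \<in> sharp_elems E" using sharp_osum[OF hom s sharp_ocompl[OF r] v(1)] .
  moreover have "t = ocompl E v"
    using v(2) compl_unique osum_ocompl osum_closed commute by metis
  ultimately show ?thesis using sharp_ocompl by simp
qed

lemma meager_sharp_zero: "m \<in> meager_elems E \<Longrightarrow> v \<in> sharp_elems E \<Longrightarrow> ole E v m \<Longrightarrow> v = ozero E"
  by (simp add: meager_elems_def)

text \<open>Uniqueness of the decomposition: the kernel exceeds \<open>s\<close> by a sharp element,
  which is forced below \<open>m\<close> and so vanishes.\<close>

lemma sharp_meager_kernel: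
  assumes hom: "homogeneous E" and s: "s \<in> sharp_elems E" and m: "m \<in> meager_elems E"
    and x: "osum E s m = Some x" and sd: "sharply_dominating E"
  shows "sharp_kernel E x = s"
proof -
  have k: "is_sharp_kernel E x (sharp_kernel E x)"
    using sharp_kernel_exists[OF sd] osum_closed[OF x] by blast
  then obtain a where a: "osum E s a = Some (sharp_kernel E x)"
    using s ole_osum(1)[OF x] unfolding is_sharp_kernel_def ole_def by blast
  have ks: "sharp_kernel E x \<in> sharp_elems E" using k unfolding is_sharp_kernel_def by blast
  obtain b where b: "osum E (sharp_kernel E x) b = Some x"
    using k unfolding is_sharp_kernel_def ole_def by blast
  obtain v where v: "osum E a b = Some v" "osum E s v = Some x" using assocD1[OF a b] .
  have "v = m" using cancel v(2) x by blast
  then have "a = ozero E"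
    using v(1) m meager_sharp_zero sharp_diff[OF hom s ks a] ole_osum by blast
  then show ?thesis using a osum_zero[OF sharp_closed[OF s]] by simp
qed

lemma sharp_meager_decomposition:
  assumes hom: "homogeneous E" and sd: "sharply_dominating E" and x: "x \<in> carrier E"
  obtains s m where "s \<in> sharp_elems E" "m \<in> meager_elems E" "osum E s m = Some x"
proof -
  let ?s = "sharp_kernel E x"
  have k: "is_sharp_kernel E x ?s" using sharp_kernel_exists[OF sd x] .
  then obtain m where m: "osum E ?s m = Some x" unfolding is_sharp_kernel_def ole_def by blast
  have s: "?s \<in> sharp_elems E" using k unfolding is_sharp_kernel_def by blast
  \<comment> \<open>A sharp \<open>v\<close> below \<open>m\<close> can be added to the kernel; the
    sum is sharp and below \<open>x\<close>, so maximality of the kernel makes \<open>v\<close>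
    zero.\<close>
  have "v = ozero E" if v: "v \<in> sharp_elems E" "ole E v m" for v
  proof -
    have "osum E m ?s = Some x" using m commute by simp
    then obtain z where z: "osum E v ?s = Some z" "ole E z x"
      using osum_mono_left[OF v(2)] by blast
    have "ole E z ?s" using k z sharp_osum[OF hom v(1) s z(1)] unfolding is_sharp_kernel_def by blast
    then have "z = ?s" using ole_antisym ole_osum(2)[OF z(1)] by blast
    then show ?thesis
      using z(1) commute cancel osum_zero[OF sharp_closed[OF s]] by metis
  qed
  then have "m \<in> meager_elems E" using osum_closed[OF m] by (simp add: meager_elems_def)
  then show ?thesis using that s m by blast
qed

section \<open>Blocks of homogeneous effect algebras\<close>

definition osums :: "'a multiset \<Rightarrow> 'a option" where
  "osums A = fold_mset (\<lambda>a r. Option.bind r (osum E a)) (Some (ozero E)) A"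

lemma comp_fun_commute_osum: "comp_fun_commute (\<lambda>a r. Option.bind r (osum E a))"
proof
  show "(\<lambda>r. Option.bind r (osum E b)) \<circ> (\<lambda>r. Option.bind r (osum E a))
      = (\<lambda>r. Option.bind r (osum E a)) \<circ> (\<lambda>r. Option.bind r (osum E b))" for a b
  proof
    fix r
    have "Option.bind (osum E a c) (osum E b) = Option.bind (osum E b c) (osum E a)" for c
      using assoc[of a b c] assoc[of b a c] commute[of a b] by simp
    then show "((\<lambda>r. Option.bind r (osum E b)) \<circ> (\<lambda>r. Option.bind r (osum E a))) r
      = ((\<lambda>r. Option.bind r (osum E a)) \<circ> (\<lambda>r. Option.bind r (osum E b))) r"
      by (cases r) auto
  qed
qed

lemma osums_empty [simp]: "osums {#} = Some (ozero E)"
  by (simp add: osums_def)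

lemma osums_add_mset: "osums (add_mset a A) = Option.bind (osums A) (osum E a)"
  unfolding osums_def
  by (rule comp_fun_commute.fold_mset_add_mset[OF comp_fun_commute_osum])

lemma osums_closed: "osums A = Some x \<Longrightarrow> x \<in> carrier E"
  by (cases A) (auto simp: osums_add_mset zero_closed bind_eq_Some_conv dest: osum_closed)

lemma osums_union: "osums (A + B) = Option.bind (osums A) (\<lambda>a. Option.bind (osums B) (osum E a))"
proof (induction A)
  case empty
  then show ?case
    using osum_zero osums_closed[of B] commute by (cases "osums B") auto
next
  case (add x A)
  show ?case
  proof (cases "osums A")
    case None
    then show ?thesis using add by (simp add: osums_add_mset)
  next
    case a: (Some a)
    show ?thesis
    proof (cases "osums B")
      case None
      then show ?thesis using add a by (cases "osum E x a") (simp_all add: osums_add_mset)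
    next
      case (Some b)
      then show ?thesis using add a assoc[of x a b] by (simp add: osums_add_mset)
    qed
  qed
qed

lemma osums_union_Some:
  "osums (A + B) = Some w \<longleftrightarrow> (\<exists>a b. osums A = Some a \<and> osums B = Some b \<and> osum E a b = Some w)"
  by (auto simp: osums_union bind_eq_Some_conv)

lemma osums_single: "a \<in> carrier E \<Longrightarrow> osums {#a#} = Some a"
  by (simp add: osums_add_mset osum_zero)

section \<open>Refinement of decompositions by homogeneity\<close>

definition covers :: "'a multiset \<Rightarrow> 'a \<Rightarrow> bool" where
  "covers W x \<longleftrightarrow> (\<exists>A. A \<subseteq># W \<and> osums A = Some x)"

text \<open>Only values of subwords are compared, without recording which letter was cut where. This
  preserves \<open>covers\<close> and is stable under adjoining words.\<close>

definition refines :: "'a multiset \<Rightarrow> 'a multiset \<Rightarrow> bool" where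
  "refines V W \<longleftrightarrow> (\<forall>A. A \<subseteq># W \<longrightarrow> (\<exists>B. B \<subseteq># V \<and> osums B = osums A))"

lemma refines_refl: "refines W W"
  unfolding refines_def by blast

lemma refines_trans: "refines U V \<Longrightarrow> refines V W \<Longrightarrow> refines U W"
  unfolding refines_def by metis

lemma refines_covers: "refines V W \<Longrightarrow> covers W x \<Longrightarrow> covers V x"
  unfolding refines_def covers_def by metis

lemma refines_union:
  assumes "refines V W" "refines V' W'"
  shows "refines (V + V') (W + W')"
  unfolding refines_def
proof (intro allI impI)
  fix A assume A: "A \<subseteq># W + W'"
  \<comment> \<open>A subword of the union splits into its part inside \<open>W\<close> and the
    excess, which fits into \<open>W'\<close>.\<close>
  have "A \<inter># W \<subseteq># W" "A - W \<subseteq># W'" using A by (simp_all add: subset_eq_diff_conv add.commute)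
  then obtain B B' where B: "B \<subseteq># V" "osums B = osums (A \<inter># W)" "B' \<subseteq># V'" "osums B' = osums (A - W)"
    using assms unfolding refines_def by meson
  have "A = A \<inter># W + (A - W)" by (auto simp: multiset_eq_iff)
  then have "osums (B + B') = osums A" using B osums_union by metis
  then show "\<exists>B. B \<subseteq># V + V' \<and> osums B = osums A"
    using B subset_mset.add_mono by blast
qed

lemma refines_split:
  assumes "osum E a b = Some c"
  shows "refines {#a, b#} {#c#}"
proof -
  have c: "a \<in> carrier E" "b \<in> carrier E" "c \<in> carrier E" using osum_closed[OF assms] by auto
  have "osums {#a, b#} = osums {#c#}" using c assms by (simp add: osums_add_mset osum_zero)
  moreover have "A = {#} \<or> A = {#c#}" if "A \<subseteq># {#c#}" for A
    using that by (cases A) (auto simp: insert_subset_eq_iff)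
  ultimately show ?thesis unfolding refines_def by (metis empty_le subset_mset.order_refl)
qed

text \<open>Each letter of \<open>A\<close> is cut along the part of \<open>y\<close> below it; the
  pieces cut off form \<open>P\<close>, the remainders \<open>Q\<close>. The two closure conditions
  on \<open>Z\<close> keep both kinds of piece in \<open>Z\<close>.\<close>

lemma refine_below:
  assumes hom: "homogeneous E"
  shows "\<lbrakk>osums A = Some a; ole E y a; ole E a (ocompl E y); set_mset A \<subseteq> Z;
     \<And>p. ole E p y \<Longrightarrow> p \<in> Z; \<And>p q c. \<lbrakk>ole E p y; c \<in> Z; osum E p q = Some c\<rbrakk> \<Longrightarrow> q \<in> Z\<rbrakk> \<Longrightarrow>
    \<exists>P Q. osums P = Some y \<and> osums (P + Q) = Some a \<and> refines (P + Q) A \<and> set_mset (P + Q) \<subseteq> Z"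
proof (induction A arbitrary: a y)
  case empty
  then have "a = ozero E" "y = ozero E" using ole_zero by auto
  then show ?case using refines_refl by (intro exI[of _ "{#}"]) auto
next
  case (add x A)
  obtain r where r: "osums A = Some r" "osum E x r = Some a"
    using add.prems(1) by (auto simp: osums_add_mset bind_eq_Some_conv)
  have y: "y \<in> carrier E" using add.prems(2) ole_carrier by blast
  obtain y2 y1 where y12: "ole E y2 x" "ole E y1 r" "osum E y2 y1 = Some y"
    using hom r(2) add.prems(2,3) unfolding homogeneous_def by blast
  \<comment> \<open>The tail inherits the hypothesis: \<open>r\<close> is below \<open>a\<close>,
    which is below the complement of \<open>y\<close>, hence of \<open>y1\<close>.\<close>
  have "ole E r (ocompl E y1)"
    using ole_trans[OF ole_osum(2)[OF r(2)]] ole_trans[OF add.prems(3)] ole_ocompl[OF ole_osum(2)[OF y12(3)]]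
    by blast
  moreover have "set_mset A \<subseteq> Z" using add.prems(4) by simp
  moreover have "\<And>p. ole E p y1 \<Longrightarrow> ole E p y" using ole_trans ole_osum(2)[OF y12(3)] by blast
  ultimately obtain P Q where PQ: "osums P = Some y1" "osums (P + Q) = Some r" "refines (P + Q) A"
      "set_mset (P + Q) \<subseteq> Z"
    using add.IH[OF r(1) y12(2)] add.prems(5,6) by blast
  obtain q where q: "osum E y2 q = Some x" using y12(1) ole_def by metis
  let ?P = "add_mset y2 P" and ?Q = "add_mset q Q"
  have "refines ((P + Q) + {#y2, q#}) (A + {#x#})"
    using refines_union[OF PQ(3) refines_split[OF q]] .
  then have "refines (?P + ?Q) (add_mset x A)" by (simp add: add_mset_commute)
  moreover have "osums ?P = Some y" using PQ(1) y12(3) by (simp add: osums_add_mset)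
  moreover have "osums (?P + ?Q) = Some a"
  proof -
    have "osum E q y2 = Some x" using q commute by simp
    then obtain v where "osum E y2 r = Some v" "osum E q v = Some a" using assocD1[OF _ r(2)] by blast
    then show ?thesis using PQ(2) by (simp add: osums_add_mset)
  qed
  moreover have "set_mset (?P + ?Q) \<subseteq> Z"
    using PQ(4) add.prems(4) add.prems(5)[OF ole_osum(1)[OF y12(3)]]
      add.prems(6)[OF ole_osum(1)[OF y12(3)] _ q] by simp
  ultimately show ?case by blast
qed

text \<open>\<open>I\<close> holds the elements along which letters may be cut, and \<open>Z\<close>
  keeps the remainder of every cut. This supplies the closure conditions of
  \<open>refine_below\<close> for all \<open>y\<close> in \<open>I\<close> at once.\<close>

definition absorbing :: "'a set \<Rightarrow> 'a set \<Rightarrow> bool" where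
  "absorbing I Z \<longleftrightarrow> I \<subseteq> Z \<and> (\<forall>y z. z \<in> I \<longrightarrow> ole E y z \<longrightarrow> y \<in> I) \<and>
     (\<forall>p q c. p \<in> I \<longrightarrow> c \<in> Z \<longrightarrow> osum E p q = Some c \<longrightarrow> q \<in> Z)"

lemma refine_below_absorbing:
  assumes "homogeneous E" "absorbing I Z" "osums A = Some a" "set_mset A \<subseteq> Z"
    and "y \<in> I" "ole E y a" "ole E a (ocompl E y)"
  obtains P Q where "osums P = Some y" "osums (P + Q) = Some a" "refines (P + Q) A" "set_mset (P + Q) \<subseteq> Z"
  using refine_below[OF assms(1,3,6,7,4)] assms(2,5) unfolding absorbing_def by blast

text \<open>Only the subword with sum \<open>x\<close> is cut; orthogonality of \<open>y\<close> to
  \<open>x\<close> is the inequality that \<open>refine_below\<close> requires.\<close>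

lemma refine_cover_below:
  assumes hom: "homogeneous E" and abs: "absorbing I Z"
    and W: "osums W = Some (ounit E)" "set_mset W \<subseteq> Z" "covers W x"
    and y: "y \<in> I" "ole E y x" "ole E y (ocompl E x)"
  obtains V where "osums V = Some (ounit E)" "set_mset V \<subseteq> Z" "refines V W" "covers V y"
proof -
  obtain A where A: "A \<subseteq># W" "osums A = Some x" using W(3) covers_def by metis
  then have AZ: "set_mset A \<subseteq> Z" using W(2) set_mset_mono by blast
  have "ole E x (ocompl E y)" using ole_ocompl_sym[OF y(3)] osums_closed[OF A(2)] .
  then obtain P Q where PQ: "osums P = Some y" "osums (P + Q) = Some x" "refines (P + Q) A"
      "set_mset (P + Q) \<subseteq> Z"
    using refine_below_absorbing[OF hom abs A(2) AZ y(1,2)] by blast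
  let ?V = "P + Q + (W - A)"
  have WA: "W = A + (W - A)" using A(1) by simp
  have "osums ?V = osums (A + (W - A))" using PQ(2) A(2) by (simp only: osums_union)
  then have "osums ?V = Some (ounit E)" using WA W(1) by simp
  moreover have "set_mset ?V \<subseteq> Z" using PQ(4) W(2) by (auto dest: in_diffD)
  moreover have "refines ?V W" using refines_union[OF PQ(3) refines_refl] WA by metis
  moreover have "P \<subseteq># ?V" by simp
  then have "covers ?V y" using PQ(1) covers_def by blast
  ultimately show ?thesis using that by blast
qed

text \<open>The part of \<open>a\<close> outside the word of \<open>b\<close> is orthogonal to \<open>b\<close>, so homogeneity moves it inside.\<close>

lemma refine_cover_diff:
  assumes hom: "homogeneous E" and abs: "absorbing I Z"
    and W: "osums W = Some (ounit E)" "set_mset W \<subseteq> Z" "covers W a" "covers W b"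
    and d: "osum E a d = Some b"
    and I: "\<And>z. \<lbrakk>ole E z a; ole E z b; ole E z (ocompl E b)\<rbrakk> \<Longrightarrow> z \<in> I"
  obtains V A B where "osums V = Some (ounit E)" "set_mset V \<subseteq> Z" "refines V W"
    "A + B \<subseteq># V" "osums A = Some a" "osums B = Some d"
proof -
  obtain U K where U: "U \<subseteq># W" "osums U = Some a" and K: "K \<subseteq># W" "osums K = Some b"
    using W covers_def by metis
  \<comment> \<open>\<open>T\<close> is the overlap of the words of \<open>a\<close> and
    \<open>b\<close>; \<open>R\<close> collects the remaining letters outside both.\<close>
  define T R where "T = U \<inter># K" and "R = W - (T + (K - U) + (U - K))"
  have UT: "U = T + (U - K)" and KT: "K = T + (K - U)"
    by (auto simp: T_def multiset_eq_iff)
  have "T + (K - U) + (U - K) \<subseteq># W"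
  proof (rule mset_subset_eqI)
    fix x
    show "count (T + (K - U) + (U - K)) x \<le> count W x"
      using mset_subset_eq_count[OF U(1), of x] mset_subset_eq_count[OF K(1), of x]
      by (simp add: T_def)
  qed
  then have WR: "W = T + (K - U) + (U - K) + R" by (simp add: R_def)
  obtain t a1 where a1: "osums T = Some t" "osums (U - K) = Some a1" "osum E t a1 = Some a"
    using U(2) UT osums_union_Some by metis
  obtain b1 where b1: "osums (K - U) = Some b1" "osum E t b1 = Some b"
    using K(2) KT osums_union_Some a1(1) option.inject by metis
  \<comment> \<open>Cancelling the value \<open>t\<close> of the overlap turns
    \<open>a + d = b\<close> into \<open>a1 + d = b1\<close>.\<close>
  obtain v where v: "osum E a1 d = Some v" "osum E t v = Some b" using assocD1[OF a1(3) d] .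
  \<comment> \<open>\<open>U - K\<close> is disjoint from \<open>K\<close> inside \<open>W\<close>,
    so \<open>b + a1\<close> is a partial sum of the unit and hence defined.\<close>
  then have db: "osum E a1 d = Some b1" using cancel b1(2) by blast
  obtain w where "osum E b a1 = Some w"
  proof -
    obtain w where "osums (K + (U - K)) = Some w"
      using W(1) WR KT osums_union_Some by metis
    then show ?thesis using that a1(2) K(2) by (auto simp: osums_union_Some)
  qed
  then have ab: "ole E b (ocompl E a1)" "ole E a1 (ocompl E b)"
    using osum_ole_ocompl commute by metis+
  have a1b: "ole E a1 b1" "ole E b1 b" "ole E a1 a" using ole_osum db b1(2) a1(3) by blast+
  have a1I: "a1 \<in> I" using I ab a1b ole_trans by blast
  have KZ: "set_mset (K - U) \<subseteq> Z" using W(2) WR by (metis set_mset_union Un_subset_iff)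
  obtain P Q where PQ: "osums P = Some a1" "osums (P + Q) = Some b1" "refines (P + Q) (K - U)"
      "set_mset (P + Q) \<subseteq> Z"
    using refine_below_absorbing[OF hom abs b1(1) KZ a1I a1b(1) ole_trans[OF a1b(2) ab(1)]] by blast
  \<comment> \<open>In the refined word of \<open>b1\<close>, \<open>P\<close> carries
    \<open>a1\<close> and \<open>Q\<close> carries \<open>d\<close>; so \<open>T + P\<close>
    replaces \<open>U\<close> as a word of \<open>a\<close>, disjoint from \<open>Q\<close>.\<close>
  let ?V = "(P + Q) + (T + (U - K) + R)"
  have W': "W = (K - U) + (T + (U - K) + R)" using WR by (simp add: ac_simps)
  have "osums ?V = osums ((K - U) + (T + (U - K) + R))"
    unfolding osums_union[of "P + Q"] osums_union[of "K - U"] using PQ(2) b1(1) by simp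
  then have "osums ?V = Some (ounit E)" using W' W(1) by simp
  moreover have "set_mset ?V \<subseteq> Z" using PQ(4) W(2) W' by (metis set_mset_union Un_subset_iff)
  moreover have "refines ?V W" using refines_union[OF PQ(3) refines_refl] W' by metis
  moreover have "(T + P) + Q \<subseteq># ?V" by (simp add: subseteq_mset_def)
  moreover have "osums (T + P) = Some a" using a1 PQ(1) osums_union_Some by blast
  moreover have "osums Q = Some d"
    using PQ(1,2) db cancel by (auto simp: osums_union_Some)
  ultimately show ?thesis using that by blast
qed

section \<open>Internally compatible sets\<close>

text \<open>The letters of the refining words come from the set itself. Each instance involves
  finitely many elements, so the property passes to unions of nonempty chains.\<close>

definition int_compat :: "'a set \<Rightarrow> bool" where
  "int_compat X \<longleftrightarrow> X \<subseteq> carrier E \<and> ounit E \<in> X \<and>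
    (\<forall>F. finite F \<longrightarrow> F \<subseteq> X \<longrightarrow>
      (\<exists>W. osums W = Some (ounit E) \<and> set_mset W \<subseteq> X \<and> (\<forall>x\<in>F. covers W x)))"

lemma int_compatE:
  assumes "int_compat X" "finite F" "F \<subseteq> X"
  obtains W where "osums W = Some (ounit E)" "set_mset W \<subseteq> X" "\<forall>x\<in>F. covers W x"
  using assms unfolding int_compat_def by meson

text \<open>A sharp \<open>x\<close> contributes only zero. Homogeneity applies to \<open>z\<close>
  against any splitting of its witness \<open>x\<close>.\<close>

definition unsharp_part :: "'a set \<Rightarrow> 'a set" where
  "unsharp_part X = {z. \<exists>x\<in>X. ole E z x \<and> ole E z (ocompl E x)}"

text \<open>The least superset of \<open>X\<close> that absorbs the unsharp part. Remainders may be
  cut again, so subtraction is iterated, but the elements subtracted always come from the original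
  \<open>X\<close>.\<close>

inductive_set unsharp_closure :: "'a set \<Rightarrow> 'a set" for X where
  base: "x \<in> X \<Longrightarrow> x \<in> unsharp_closure X"
| part: "z \<in> unsharp_part X \<Longrightarrow> z \<in> unsharp_closure X"
| diff: "d \<in> unsharp_closure X \<Longrightarrow> z \<in> unsharp_part X \<Longrightarrow> osum E z e = Some d \<Longrightarrow> e \<in> unsharp_closure X"

lemma unsharp_part_down: "z \<in> unsharp_part X \<Longrightarrow> ole E y z \<Longrightarrow> y \<in> unsharp_part X"
  unfolding unsharp_part_def using ole_trans by blast

lemma absorbing_unsharp_closure: "absorbing (unsharp_part X) (unsharp_closure X)"
  unfolding absorbing_def
  using unsharp_closure.part unsharp_closure.diff unsharp_part_down by blast

text \<open>The form with a finite \<open>G\<close> inside \<open>X\<close> is chosen for iteration: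
  refining a word keeps \<open>G\<close> covered, so elements of the closure can be covered one
  after another.\<close>

lemma unsharp_closure_refine:
  assumes hom: "homogeneous E" and e: "e \<in> unsharp_closure X"
  shows "\<exists>G. finite G \<and> G \<subseteq> X \<and> (\<forall>W. osums W = Some (ounit E) \<longrightarrow> set_mset W \<subseteq> unsharp_closure X
    \<longrightarrow> (\<forall>g\<in>G. covers W g) \<longrightarrow> (\<exists>V. osums V = Some (ounit E) \<and> set_mset V \<subseteq> unsharp_closure X
      \<and> refines V W \<and> covers V e))"
  using e
proof induction
  case (base x)
  then show ?case using refines_refl by (intro exI[of _ "{x}"]) auto
next
  case (part z)
  then obtain x where x: "x \<in> X" "ole E z x" "ole E z (ocompl E x)" unfolding unsharp_part_def by blast
  show ?case
  proof (intro exI[of _ "{x}"] conjI allI impI)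
    fix W assume W: "osums W = Some (ounit E)" "set_mset W \<subseteq> unsharp_closure X" "\<forall>g\<in>{x}. covers W g"
    then obtain V where "osums V = Some (ounit E)" "set_mset V \<subseteq> unsharp_closure X"
        "refines V W" "covers V z"
      using refine_cover_below[OF hom absorbing_unsharp_closure W(1,2) _ part x(2,3)] by blast
    then show "\<exists>V. osums V = Some (ounit E) \<and> set_mset V \<subseteq> unsharp_closure X \<and> refines V W \<and> covers V z"
      by blast
  qed (use x in auto)
next
  case (diff d z e)
  then obtain x where x: "x \<in> X" "ole E z x" "ole E z (ocompl E x)" unfolding unsharp_part_def by blast
  obtain G where G: "finite G" "G \<subseteq> X" "\<And>W. osums W = Some (ounit E) \<Longrightarrow> set_mset W \<subseteq> unsharp_closure X
    \<Longrightarrow> (\<forall>g\<in>G. covers W g) \<Longrightarrow> (\<exists>V. osums V = Some (ounit E) \<and> set_mset V \<subseteq> unsharp_closure X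
      \<and> refines V W \<and> covers V d)" using diff.IH by auto
  show ?case
  proof (intro exI[of _ "insert x G"] conjI allI impI)
    fix W assume W: "osums W = Some (ounit E)" "set_mset W \<subseteq> unsharp_closure X"
      "\<forall>g\<in>insert x G. covers W g"
    obtain V1 where V1: "osums V1 = Some (ounit E)" "set_mset V1 \<subseteq> unsharp_closure X"
      "refines V1 W" "covers V1 d" using G(3)[OF W(1,2)] W(3) by auto
    have "covers V1 x" using V1(3) W(3) refines_covers by blast
    then obtain V2 where V2: "osums V2 = Some (ounit E)" "set_mset V2 \<subseteq> unsharp_closure X"
      "refines V2 V1" "covers V2 z"
      using refine_cover_below[OF hom absorbing_unsharp_closure V1(1,2) _ diff.hyps(2) x(2,3)] by blast
    \<comment> \<open>With \<open>z\<close> in the role of \<open>a\<close>, all elements below it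
      lie in the down-closed unsharp part, as \<open>refine_cover_diff\<close> demands.\<close>
    obtain V A B where V: "osums V = Some (ounit E)" "set_mset V \<subseteq> unsharp_closure X"
      "refines V V2" "A + B \<subseteq># V" "osums B = Some e"
      using refine_cover_diff[OF hom absorbing_unsharp_closure V2(1,2,4)
          refines_covers[OF V2(3) V1(4)] diff.hyps(3)] unsharp_part_down[OF diff.hyps(2)] by metis
    have "B \<subseteq># V" using V(4) by (metis mset_subset_eq_add_right subset_mset.order_trans)
    then have "covers V e" using V(5) covers_def by blast
    then show "\<exists>V. osums V = Some (ounit E) \<and> set_mset V \<subseteq> unsharp_closure X \<and> refines V W \<and> covers V e"
      using V V2 V1 refines_trans by blast
  qed (use G x in auto)
qed

lemma int_compat_unsharp_closure:
  assumes hom: "homogeneous E" and X: "int_compat X"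
  shows "int_compat (unsharp_closure X)"
proof -
  let ?Z = "unsharp_closure X"
  have refine: "\<exists>G. finite G \<and> G \<subseteq> X \<and> (\<forall>W. osums W = Some (ounit E) \<longrightarrow> set_mset W \<subseteq> ?Z
    \<longrightarrow> (\<forall>g\<in>G. covers W g) \<longrightarrow> (\<exists>V. osums V = Some (ounit E) \<and> set_mset V \<subseteq> ?Z
      \<and> refines V W \<and> (\<forall>x\<in>F. covers V x)))" if "finite F" "F \<subseteq> ?Z" for F
    using that
  proof induction
    case empty
    then show ?case using refines_refl by (intro exI[of _ "{}"]) auto
  next
    case (insert e F)
    then obtain G where G: "finite G" "G \<subseteq> X" "\<And>W. osums W = Some (ounit E) \<Longrightarrow> set_mset W \<subseteq> ?Z
    \<Longrightarrow> (\<forall>g\<in>G. covers W g) \<Longrightarrow> (\<exists>V. osums V = Some (ounit E) \<and> set_mset V \<subseteq> ?Z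
      \<and> refines V W \<and> (\<forall>x\<in>F. covers V x))" by auto
    obtain H where H: "finite H" "H \<subseteq> X" "\<And>W. osums W = Some (ounit E) \<Longrightarrow> set_mset W \<subseteq> ?Z
    \<Longrightarrow> (\<forall>g\<in>H. covers W g) \<Longrightarrow> (\<exists>V. osums V = Some (ounit E) \<and> set_mset V \<subseteq> ?Z
      \<and> refines V W \<and> covers V e)" using unsharp_closure_refine[OF hom] insert.prems by (metis insert_subset)
    show ?case
    proof (intro exI[of _ "G \<union> H"] conjI allI impI)
      fix W assume W: "osums W = Some (ounit E)" "set_mset W \<subseteq> ?Z" "\<forall>g\<in>G \<union> H. covers W g"
      then obtain V where V: "osums V = Some (ounit E)" "set_mset V \<subseteq> ?Z" "refines V W" "\<forall>x\<in>F. covers V x"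
        using G(3)[OF W(1,2)] by auto
      have "\<forall>g\<in>H. covers V g" using V(3) W(3) refines_covers by blast
      then obtain V' where V': "osums V' = Some (ounit E)" "set_mset V' \<subseteq> ?Z" "refines V' V" "covers V' e"
        using H(3)[OF V(1,2)] by blast
      then show "\<exists>V. osums V = Some (ounit E) \<and> set_mset V \<subseteq> ?Z \<and> refines V W \<and> (\<forall>x\<in>insert e F. covers V x)"
        using V refines_trans refines_covers by blast
    qed (use G H in auto)
  qed
  have "x \<in> carrier E" if "x \<in> ?Z" for x
    using that
    by induction (use X osum_closed ole_carrier in \<open>auto simp: int_compat_def unsharp_part_def\<close>)
  moreover have "\<exists>W. osums W = Some (ounit E) \<and> set_mset W \<subseteq> ?Z \<and> (\<forall>x\<in>F. covers W x)"
    if F: "finite F" "F \<subseteq> ?Z" for F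
  proof -
    obtain G where G: "finite G" "G \<subseteq> X" "\<And>W. osums W = Some (ounit E) \<Longrightarrow> set_mset W \<subseteq> ?Z
    \<Longrightarrow> (\<forall>g\<in>G. covers W g) \<Longrightarrow> (\<exists>V. osums V = Some (ounit E) \<and> set_mset V \<subseteq> ?Z
      \<and> refines V W \<and> (\<forall>x\<in>F. covers V x))" using refine[OF F] by auto
    obtain W where "osums W = Some (ounit E)" "set_mset W \<subseteq> X" "\<forall>g\<in>G. covers W g"
      using int_compatE[OF X G(1,2)] .
    then show ?thesis using G(3)[of W] unsharp_closure.base by blast
  qed
  moreover have "ounit E \<in> ?Z" using X unsharp_closure.base by (simp add: int_compat_def)
  ultimately show ?thesis unfolding int_compat_def by (intro conjI allI impI subsetI)
qed

lemma sub_effect_algebra_osums: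
  assumes "sub_effect_algebra E X" "osums A = Some x" "set_mset A \<subseteq> X"
  shows "x \<in> X"
  using assms(2,3)
proof (induction A arbitrary: x)
  case empty
  then show ?case using assms(1) unit_osum_zero unfolding sub_effect_algebra_def by auto
next
  case (add a A)
  then show ?case
    using assms(1) unfolding sub_effect_algebra_def
    by (auto simp: osums_add_mset bind_eq_Some_conv)
qed

section \<open>Maximal internally compatible sets\<close>

context
  fixes X
  assumes hom: "homogeneous E" and X: "int_compat X"
    and max: "\<And>Y. int_compat Y \<Longrightarrow> X \<subseteq> Y \<Longrightarrow> Y = X"
begin

lemma max_int_compat_closure: "unsharp_closure X = X"
  using max int_compat_unsharp_closure[OF hom X] unsharp_closure.base by blast

lemma max_int_compat_absorbing: "absorbing (unsharp_part X) X"
  using absorbing_unsharp_closure[of X] max_int_compat_closure by simp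

text \<open>Keeping a finite \<open>F\<close> covered serves two purposes: adjoining
  \<open>d\<close> to \<open>X\<close>, and comparing \<open>d\<close> with a further element in the
  decomposition property.\<close>

lemma max_int_compat_refine_diff:
  assumes F: "finite F" "F \<subseteq> X" and ab: "a \<in> X" "b \<in> X" "osum E a d = Some b"
  obtains V A B where "osums V = Some (ounit E)" "set_mset V \<subseteq> X" "\<forall>x\<in>F. covers V x"
    "A + B \<subseteq># V" "osums A = Some a" "osums B = Some d"
proof -
  have "finite (insert a (insert b F))" "insert a (insert b F) \<subseteq> X" using F ab by auto
  then obtain W where W: "osums W = Some (ounit E)" "set_mset W \<subseteq> X" "\<forall>x\<in>insert a (insert b F). covers W x"
    by (rule int_compatE[OF X])
  have Wab: "covers W a" "covers W b" using W(3) by auto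
  have "\<And>z. ole E z b \<Longrightarrow> ole E z (ocompl E b) \<Longrightarrow> z \<in> unsharp_part X"
    using ab(2) unfolding unsharp_part_def by blast
  then show ?thesis
    using refine_cover_diff[OF hom max_int_compat_absorbing W(1,2) Wab ab(3)] that W(3) refines_covers
    by (metis insertCI)
qed

text \<open>The refining words have letters in \<open>X\<close> and already cover \<open>d\<close>,
  so adjoining \<open>d\<close> preserves internal compatibility and maximality applies.\<close>

lemma max_int_compat_diff:
  assumes "a \<in> X" "b \<in> X" "osum E a d = Some b"
  shows "d \<in> X"
proof -
  have "int_compat (insert d X)"
    unfolding int_compat_def
  proof (intro conjI allI impI)
    fix F assume F: "finite F" "F \<subseteq> insert d X"
    obtain V A B where V: "osums V = Some (ounit E)" "set_mset V \<subseteq> X" "\<forall>x\<in>F - {d}. covers V x"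
      "A + B \<subseteq># V" "osums A = Some a" "osums B = Some d"
      using max_int_compat_refine_diff[of "F - {d}", OF _ _ assms] F by blast
    have "B \<subseteq># V" using V(4) by (metis mset_subset_eq_add_right subset_mset.order_trans)
    then have "covers V d" using V(6) covers_def by blast
    then show "\<exists>W. osums W = Some (ounit E) \<and> set_mset W \<subseteq> insert d X \<and> (\<forall>x\<in>F. covers W x)"
      using V by blast
  qed (use X osum_closed[OF assms(3)] in \<open>auto simp: int_compat_def\<close>)
  then show ?thesis using max by blast
qed

lemma max_int_compat_sub_effect_algebra: "sub_effect_algebra E X"
proof -
  have XC: "X \<subseteq> carrier E" "ounit E \<in> X" using X by (auto simp: int_compat_def)
  have compl: "ocompl E x \<in> X" if "x \<in> X" for x
    using that max_int_compat_diff XC osum_ocompl by blast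
  \<comment> \<open>Sums reduce to differences: the complement of \<open>x + y\<close> is the
    complement of \<open>x\<close> minus \<open>y\<close>.\<close>
  have sum: "z \<in> X" if xy: "x \<in> X" "y \<in> X" "osum E x y = Some z" for x y z
  proof -
    have "osum E z (ocompl E z) = Some (ounit E)" using osum_ocompl osum_closed xy(3) by blast
    then obtain v where v: "osum E y (ocompl E z) = Some v" "osum E x v = Some (ounit E)"
      using assocD1[OF xy(3)] by blast
    then have "ocompl E z \<in> X" using max_int_compat_diff xy XC by blast
    then show ?thesis using compl ocompl_ocompl osum_closed[OF xy(3)] by metis
  qed
  show ?thesis unfolding sub_effect_algebra_def
    using XC sum max_int_compat_diff commute by metis
qed

text \<open>In a word that realises \<open>v1\<close> and \<open>v2\<close> on disjoint subwords and
  also covers \<open>u\<close>, intersection splits the shared part of \<open>u\<close>. The other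
  letters of \<open>u\<close> give an element orthogonal to \<open>v\<close>, which homogeneity can
  split.\<close>

lemma max_int_compat_riesz: "riesz_decomposition (sub_ealg E X)"
  unfolding riesz_decomposition_def
proof (intro allI impI)
  fix u v1 v2 v
  assume "osum (sub_ealg E X) v1 v2 = Some v \<and> ole (sub_ealg E X) u v"
  then obtain e where v: "osum E v1 v2 = Some v" "v1 \<in> X" "v2 \<in> X" "v \<in> X"
    and u: "osum E u e = Some v" "u \<in> X"
    by (auto simp: sub_ealg_def osum_on_Some ole_def)
  obtain V A B where V: "osums V = Some (ounit E)" "set_mset V \<subseteq> X" "\<forall>x\<in>{u}. covers V x"
      "A + B \<subseteq># V" "osums A = Some v1" "osums B = Some v2"
    by (rule max_int_compat_refine_diff[of "{u}" v1 v v2]) (use v u in auto)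
  then obtain U where U: "U \<subseteq># V" "osums U = Some u" unfolding covers_def by blast
  \<comment> \<open>\<open>?C\<close> and \<open>?D\<close> are the letters of \<open>u\<close>
    charged to \<open>v1\<close> and \<open>v2\<close>; removing \<open>A\<close> before meeting
    \<open>B\<close> avoids charging an occurrence twice.\<close>
  let ?C = "U \<inter># A" and ?D = "(U - A) \<inter># B" and ?U = "U - A - B"
  have "U = (?C + ?D) + ?U" "A = ?C + (A - U)" "B = ?D + (B - (U - A))"
    by (auto simp: multiset_eq_iff)
  then have split: "osums ((?C + ?D) + ?U) = Some u" "osums (?C + (A - U)) = Some v1"
      "osums (?D + (B - (U - A))) = Some v2"
    using U(2) V(5,6) by (auto simp only:)
  obtain x a1 where xa: "osums (?C + ?D) = Some x" "osums ?U = Some a1" "osum E x a1 = Some u"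
    using split(1) osums_union_Some by blast
  obtain x1 x2 where x12: "osums ?C = Some x1" "osums ?D = Some x2" "osum E x1 x2 = Some x"
    using xa(1) osums_union_Some by blast
  obtain p where p: "osums (A - U) = Some p" "osum E x1 p = Some v1"
    using split(2) x12(1) by (auto simp: osums_union_Some)
  obtain q where q: "osums (B - (U - A)) = Some q" "osum E x2 q = Some v2"
    using split(3) x12(2) by (auto simp: osums_union_Some)
  obtain x' r where "osum E x1 x2 = Some x'" and r: "osum E p q = Some r" "osum E x' r = Some v"
    using osum_interchange[OF p(2) q(2) v(1)] .
  then have xr: "osum E x r = Some v" using x12(3) by simp
  obtain k where k: "osum E a1 e = Some k" "osum E x k = Some v" using assocD1[OF xa(3) u(1)] .
  have "k = r" using cancel k(2) xr by blast
  then have a1r: "ole E a1 r" using ole_osum(1)[OF k(1)] by simp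
  have rv: "ole E r v" using ole_osum(2)[OF xr] .
  \<comment> \<open>Disjointness of \<open>?U\<close> from \<open>A + B\<close> makes
    \<open>v + a1\<close> defined, hence \<open>v\<close> lies below the complement of
    \<open>a1\<close>.\<close>
  have "A + B + ?U \<subseteq># V"
  proof (rule mset_subset_eqI)
    fix z
    show "count (A + B + ?U) z \<le> count V z"
      using mset_subset_eq_count[OF U(1), of z] mset_subset_eq_count[OF V(4), of z] by simp
  qed
  then obtain w where "osums (A + B + ?U) = Some w"
    using V(1) osums_union_Some by (metis subset_mset.add_diff_inverse)
  then have "osum E v a1 = Some w" using V(5,6) v(1) xa(2) by (auto simp: osums_union_Some)
  then have va: "ole E v (ocompl E a1)" "ole E a1 (ocompl E v)"
    using osum_ole_ocompl commute by metis+
  obtain c1 c2 where c: "ole E c1 p" "ole E c2 q" "osum E c1 c2 = Some a1"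
    using hom a1r r(1) ole_trans[OF rv va(1)] unfolding homogeneous_def by blast
  obtain u1 u2 where u12: "osum E x1 c1 = Some u1" "osum E x2 c2 = Some u2" "osum E u1 u2 = Some u"
    using osum_interchange[OF x12(3) c(3) xa(3)] .
  \<comment> \<open>Homogeneity places \<open>c1\<close> and \<open>c2\<close> only in
    \<open>E\<close>; they belong to \<open>X\<close> because \<open>a1\<close> lies below
    \<open>v\<close> and its complement.\<close>
  have "a1 \<in> unsharp_part X"
    using va(2) ole_trans[OF a1r rv] v(4) unfolding unsharp_part_def by blast
  then have cX: "c1 \<in> X" "c2 \<in> X"
    using max_int_compat_absorbing ole_osum[OF c(3)] unfolding absorbing_def by blast+
  have sub: "sub_effect_algebra E X" by (rule max_int_compat_sub_effect_algebra)
  have "?C \<subseteq># V" "?D \<subseteq># V" 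
    using U(1) by (meson subset_mset.inf_le1 diff_subset_eq_self subset_mset.order_trans)+
  then have "x1 \<in> X" "x2 \<in> X"
    using sub_effect_algebra_osums[OF sub] x12(1,2) V(2) set_mset_mono by (meson subset_trans)+
  then have uX: "u1 \<in> X" "u2 \<in> X"
    using sub u12 cX unfolding sub_effect_algebra_def by blast+
  \<comment> \<open>The order of the subalgebra requires the difference to lie in \<open>X\<close>
    too.\<close>
  have le: "ole (sub_ealg E X) s t" if st: "osum E z b = Some s" "osum E z r = Some t"
      "ole E b r" "s \<in> X" "t \<in> X" for z b r s t
  proof -
    obtain g where g: "osum E b g = Some r" using st(3) ole_def by metis
    obtain h where h: "osum E z b = Some h" "osum E h g = Some t" using assocD2[OF g st(2)] .
    then have "osum E s g = Some t" using st(1) by simp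
    moreover have "g \<in> X" using max_int_compat_diff calculation st by blast
    ultimately have "osum (sub_ealg E X) s g = Some t"
      using st by (simp add: sub_ealg_def osum_on_Some)
    then show ?thesis unfolding ole_def by blast
  qed
  show "\<exists>u1 u2. ole (sub_ealg E X) u1 v1 \<and> ole (sub_ealg E X) u2 v2 \<and> osum (sub_ealg E X) u1 u2 = Some u"
    using le[OF u12(1) p(2) c(1) uX(1) v(2)] le[OF u12(2) q(2) c(2) uX(2) v(3)] u12(3) uX u(2)
    by (intro exI[of _ u1] exI[of _ u2]) (simp add: sub_ealg_def osum_on_Some)
qed

end

section \<open>Existence of blocks\<close>

text \<open>The same word serves every finite subset, since its letters are themselves
  subsums.\<close>

lemma int_compat_subsums:
  assumes "osums W = Some (ounit E)"
  shows "int_compat {x. covers W x}"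
  unfolding int_compat_def
proof (intro conjI allI impI)
  show "{x. covers W x} \<subseteq> carrier E" using osums_closed by (auto simp: covers_def)
  show "ounit E \<in> {x. covers W x}" using assms by (auto simp: covers_def)
  have "covers W x" if x: "x \<in># W" for x
  proof -
    obtain V where V: "W = add_mset x V" using multi_member_split[OF x] by blast
    then have "x \<in> carrier E" using assms osum_closed by (auto simp: osums_add_mset bind_eq_Some_conv)
    moreover have "{#x#} \<subseteq># W" using x by simp
    ultimately show ?thesis using osums_single unfolding covers_def by blast
  qed
  then show "\<exists>V. osums V = Some (ounit E) \<and> set_mset V \<subseteq> {x. covers W x} \<and> (\<forall>x\<in>F. covers V x)"
    if "finite F" "F \<subseteq> {x. covers W x}" for F
    using assms that by (intro exI[of _ W]) auto
qed

text \<open>Zorn's lemma applies because each instance of closure or decomposition starts from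
  finitely many elements, all found in one member of the chain.\<close>

lemma block_extends:
  assumes X: "sub_effect_algebra E X" "riesz_decomposition (sub_ealg E X)"
  obtains B where "block E B" "X \<subseteq> B"
proof -
  let ?S = "{C. sub_effect_algebra E C \<and> riesz_decomposition (sub_ealg E C) \<and> X \<subseteq> C}"
  have "\<exists>B\<in>?S. \<forall>C\<in>?S. B \<subseteq> C \<longrightarrow> C = B"
  proof (rule subset_Zorn_nonempty)
    show "?S \<noteq> {}" using X by blast
    fix \<C> assume C: "\<C> \<noteq> {}" "subset.chain ?S \<C>"
    have CS: "\<C> \<subseteq> ?S" using C(2) by (simp add: subset.chain_def)
    have dir: "\<exists>C\<in>\<C>. F \<subseteq> C" if "finite F" "F \<subseteq> \<Union>\<C>" for F
      using finite_subset_Union_chain[OF that C] by blast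
    have sub: "sub_effect_algebra E (\<Union>\<C>)"
      unfolding sub_effect_algebra_def
    proof (intro conjI allI impI)
      show "\<Union>\<C> \<subseteq> carrier E" using CS by (auto simp: sub_effect_algebra_def)
      show "ounit E \<in> \<Union>\<C>" using CS C(1) by (auto simp: sub_effect_algebra_def)
      fix x y z assume s: "osum E x y = Some z"
      show "z \<in> \<Union>\<C>" if mem: "x \<in> \<Union>\<C> \<and> y \<in> \<Union>\<C>"
      proof -
        obtain C where C: "C \<in> \<C>" "x \<in> C" "y \<in> C" using dir[of "{x, y}"] mem by auto
        then have "sub_effect_algebra E C" using CS by blast
        then have "z \<in> C" using C s unfolding sub_effect_algebra_def by blast
        then show ?thesis using C by blast
      qed
      show "y \<in> \<Union>\<C>" if mem: "x \<in> \<Union>\<C> \<and> z \<in> \<Union>\<C>"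
      proof -
        obtain C where C: "C \<in> \<C>" "x \<in> C" "z \<in> C" using dir[of "{x, z}"] mem by auto
        then have "sub_effect_algebra E C" using CS by blast
        then have "y \<in> C" using C s unfolding sub_effect_algebra_def by blast
        then show ?thesis using C by blast
      qed
      show "x \<in> \<Union>\<C>" if mem: "y \<in> \<Union>\<C> \<and> z \<in> \<Union>\<C>"
      proof -
        obtain C where C: "C \<in> \<C>" "y \<in> C" "z \<in> C" using dir[of "{y, z}"] mem by auto
        then have "sub_effect_algebra E C" using CS by blast
        then have "x \<in> C" using C s unfolding sub_effect_algebra_def by blast
        then show ?thesis using C by blast
      qed
    qed
    have "riesz_decomposition (sub_ealg E (\<Union>\<C>))"
      unfolding riesz_decomposition_def
    proof (intro allI impI)
      fix u v1 v2 v
      assume "osum (sub_ealg E (\<Union>\<C>)) v1 v2 = Some v \<and> ole (sub_ealg E (\<Union>\<C>)) u v"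
      \<comment> \<open>The witness \<open>e\<close> of \<open>u\<close> below \<open>v\<close> is
        included so that the inequality also holds inside the chain member.\<close>
      then obtain e where v: "osum E v1 v2 = Some v" "osum E u e = Some v"
        and "{v1, v2, v, u, e} \<subseteq> \<Union>\<C>"
        by (auto simp: sub_ealg_def osum_on_Some ole_def)
      then obtain C where C: "C \<in> \<C>" "{v1, v2, v, u, e} \<subseteq> C" using dir[of "{v1, v2, v, u, e}"] by auto
      then have "osum (sub_ealg E C) v1 v2 = Some v" "ole (sub_ealg E C) u v"
        using v by (auto simp: sub_ealg_def osum_on_Some ole_def)
      moreover have "riesz_decomposition (sub_ealg E C)" using C CS by blast
      ultimately obtain u1 u2 where "ole (sub_ealg E C) u1 v1" "ole (sub_ealg E C) u2 v2"
          "osum (sub_ealg E C) u1 u2 = Some u"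
        unfolding riesz_decomposition_def by blast
      then show "\<exists>u1 u2. ole (sub_ealg E (\<Union>\<C>)) u1 v1 \<and> ole (sub_ealg E (\<Union>\<C>)) u2 v2 \<and>
          osum (sub_ealg E (\<Union>\<C>)) u1 u2 = Some u"
        using C(1) by (auto simp: sub_ealg_def osum_on_Some ole_def)
    qed
    then show "\<Union>\<C> \<in> ?S" using sub CS C(1) by blast
  qed
  then obtain B where B: "B \<in> ?S" "\<forall>C\<in>?S. B \<subseteq> C \<longrightarrow> C = B" ..
  have "C = B" if "sub_effect_algebra E C \<and> riesz_decomposition (sub_ealg E C) \<and> B \<subseteq> C" for C
    using B(2)[THEN bspec, of C] B(1) that by auto
  then show ?thesis using B(1) that unfolding block_def by auto
qed

lemma orthogonal_pair_in_block:
  assumes hom: "homogeneous E" and mn: "osum E m n = Some r"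
  obtains B where "block E B" "m \<in> B" "n \<in> B"
proof -
  have c: "m \<in> carrier E" "n \<in> carrier E" "r \<in> carrier E" using osum_closed[OF mn] by auto
  \<comment> \<open>The unit is decomposed into \<open>m\<close>, \<open>n\<close> and the
    complement of their sum; its subsums give the first internally compatible set containing
    both.\<close>
  let ?W = "{#ocompl E r#} + ({#m#} + {#n#})"
  have one: "osums {#m#} = Some m" "osums {#n#} = Some n" "osums {#ocompl E r#} = Some (ocompl E r)"
    using osums_single c ocompl_closed by simp_all
  have "osum E (ocompl E r) r = Some (ounit E)" using osum_ocompl[OF c(3)] commute by simp
  then have "osums ?W = Some (ounit E)" using one mn unfolding osums_union by simp
  then have X0: "int_compat {x. covers ?W x}" by (rule int_compat_subsums)
  have "{#m#} \<subseteq># ?W" "{#n#} \<subseteq># ?W" by simp_all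
  then have mnX: "covers ?W m" "covers ?W n" using one unfolding covers_def by blast+
  let ?S = "{X. int_compat X \<and> {m, n} \<subseteq> X}"
  have "\<exists>X\<in>?S. \<forall>Y\<in>?S. X \<subseteq> Y \<longrightarrow> Y = X"
  proof (rule subset_Zorn_nonempty)
    show "?S \<noteq> {}" using X0 mnX by blast
    fix \<C> assume C: "\<C> \<noteq> {}" "subset.chain ?S \<C>"
    have CS: "\<C> \<subseteq> ?S" using C(2) by (simp add: subset.chain_def)
    have "\<exists>W. osums W = Some (ounit E) \<and> set_mset W \<subseteq> \<Union>\<C> \<and> (\<forall>x\<in>F. covers W x)"
      if F: "finite F" "F \<subseteq> \<Union>\<C>" for F
    proof -
      obtain X where X: "X \<in> \<C>" "F \<subseteq> X" using finite_subset_Union_chain[OF F C] by blast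
      then have "int_compat X" using CS by blast
      then obtain W where "osums W = Some (ounit E)" "set_mset W \<subseteq> X" "\<forall>x\<in>F. covers W x"
        using int_compatE F(1) X(2) by blast
      then show ?thesis using X(1) by blast
    qed
    moreover have "\<Union>\<C> \<subseteq> carrier E" "ounit E \<in> \<Union>\<C>"
      using CS C(1) by (auto simp: int_compat_def)
    ultimately have "int_compat (\<Union>\<C>)"
      unfolding int_compat_def by (intro conjI allI impI)
    then show "\<Union>\<C> \<in> ?S" using CS C(1) by blast
  qed
  then obtain X where X: "X \<in> ?S" "\<forall>Y\<in>?S. X \<subseteq> Y \<longrightarrow> Y = X" ..
  have ic: "int_compat X" using X(1) by simp
  have max: "Y = X" if "int_compat Y" "X \<subseteq> Y" for Y
    using X(2)[THEN bspec, of Y] X(1) that by auto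
  obtain B where "block E B" "X \<subseteq> B"
    using block_extends[OF max_int_compat_sub_effect_algebra[OF hom ic max] max_int_compat_riesz[OF hom ic max]] .
  then show ?thesis using that X(1) by blast
qed

end

section \<open>Sums of meager elements in TRT-effect algebras\<close>

context trt_effect_algebra
begin

lemma sharp_cover_is: "x \<in> carrier E \<Longrightarrow> is_sharp_cover E x (sharp_cover E x)"
  using sharply_dominating sharp_cover_eqI unfolding sharply_dominating_def by metis

lemma meager_sum_iff:
  "osum (meager_alg E) x y = Some z \<longleftrightarrow> osum E x y = Some z \<and> z \<in> meager_elems E"
  using osum_on_Some meager_down ole_osum by (auto simp: meager_alg_def)

text \<open>The cover of \<open>m\<close> and \<open>v\<close> differ by a sharp element below the
  meager \<open>n\<close>, so they coincide. Then \<open>n\<close> is the cover minus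
  \<open>m\<close>, the element singled out by \<open>trt\<close>.\<close>

lemma meager_split_sharp:
  assumes m: "m \<in> meager_elems E" and n: "n \<in> meager_elems E" and v: "v \<in> sharp_elems E"
    and sum: "osum E m n = Some v"
  shows "sharp_cover E m = v" "trt_condition E m n"
proof -
  let ?c = "sharp_cover E m"
  have c: "is_sharp_cover E m ?c" by (rule sharp_cover_is[OF meager_closed[OF m]])
  then have cS: "?c \<in> sharp_elems E" and mc: "ole E m ?c" and cv: "ole E ?c v"
    using v ole_osum(1)[OF sum] unfolding is_sharp_cover_def by auto
  obtain d where d: "osum E ?c d = Some v" using cv ole_def by metis
  obtain e where e: "osum E m e = Some ?c" using mc ole_def by metis
  obtain w where w: "osum E e d = Some w" "osum E m w = Some v" using assocD1[OF e d] .
  have "w = n" using cancel w(2) sum by blast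
  then have "d = ozero E"
    using n meager_sharp_zero sharp_diff[OF homogeneous cS v d] ole_osum(2)[OF w(1)] by blast
  then show cov: "?c = v" using d osum_zero[OF sharp_closed[OF cS]] by simp
  obtain y where y: "is_odiff E ?c m y" "trt_condition E m y" using trt[OF m] by blast
  then have "y = n" using sum cov cancel unfolding is_odiff_def by metis
  then show "trt_condition E m n" using y(2) by simp
qed

text \<open>A block containing both summands contains the sharp kernel of the sum, which the Riesz
  decomposition property then splits along the summands.\<close>

lemma meager_sum_decomposition:
  assumes m: "m \<in> meager_elems E" and n: "n \<in> meager_elems E" and r: "osum E m n = Some r"
  obtains v k m1 m2 n1 n2 where "v \<in> sharp_elems E" "k \<in> meager_elems E" "osum E v k = Some r"
    "osum E m1 m2 = Some m" "osum E n1 n2 = Some n" "osum E m1 n1 = Some v" "osum E m2 n2 = Some k"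
proof -
  obtain B where B: "block E B" "m \<in> B" "n \<in> B" using orthogonal_pair_in_block[OF homogeneous r] .
  then have sub: "sub_effect_algebra E B" and rdp: "riesz_decomposition (sub_ealg E B)"
    by (auto simp: block_def)
  have rB: "r \<in> B" using sub B r unfolding sub_effect_algebra_def by blast
  have rc: "r \<in> carrier E" using osum_closed[OF r] by blast
  obtain v k where vk: "v \<in> sharp_elems E" "k \<in> meager_elems E" "osum E v k = Some r"
    using sharp_meager_decomposition[OF homogeneous sharply_dominating rc] .
  have "v = sharp_kernel E r"
    using sharp_meager_kernel[OF homogeneous vk sharply_dominating] by simp
  then have "v \<in> {z \<in> carrier E. ole E (sharp_kernel E r) z \<and> ole E z r}"
    using ole_refl ole_osum(1)[OF vk(3)] sharp_closed[OF vk(1)] by simp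
  then have vB: "v \<in> B" using block_interval[OF B(1) rB] by blast
  then have "k \<in> B" using sub rB vk(3) unfolding sub_effect_algebra_def by blast
  then have "ole (sub_ealg E B) v r" "osum (sub_ealg E B) m n = Some r"
    using vB rB B r vk(3) by (auto simp: ole_def sub_ealg_def osum_on_Some)
  then obtain m1 n1 where "ole (sub_ealg E B) m1 m" "ole (sub_ealg E B) n1 n"
      "osum (sub_ealg E B) m1 n1 = Some v"
    using rdp unfolding riesz_decomposition_def by blast
  then obtain m2 n2 where d: "osum E m1 m2 = Some m" "osum E n1 n2 = Some n" "osum E m1 n1 = Some v"
    by (auto simp: ole_def sub_ealg_def osum_on_Some)
  \<comment> \<open>Regrouping and cancelling \<open>v\<close> shows that the remainders
    \<open>m2\<close> and \<open>n2\<close> add up to \<open>k\<close>.\<close>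
  obtain p q where pq: "osum E m1 n1 = Some p" "osum E m2 n2 = Some q" "osum E p q = Some r"
    using osum_interchange[OF d(1,2) r] .
  then have "q = k" using d(3) vk(3) cancel by simp
  then show ?thesis using that vk d pq(2) by blast
qed

end

section \<open>Isomorphisms of triples\<close>

text \<open>Only one direction of an isomorphism is recorded; its inverse is a second instance with
  \<open>E\<close> and \<open>F\<close> exchanged. The link \<open>meager_le\<close> between the two
  maps comes from \<open>h\<close>.\<close>

locale triple_map = E: trt_effect_algebra E + F: trt_effect_algebra F
  for E :: "'a ealg" and F :: "'b ealg" +
  fixes \<sigma> \<mu> :: "'a \<Rightarrow> 'b"
  assumes sharp_image: "s \<in> sharp_elems E \<Longrightarrow> \<sigma> s \<in> sharp_elems F"
    and sharp_sum: "\<lbrakk>s \<in> sharp_elems E; t \<in> sharp_elems E; osum E s t = Some r\<rbrakk>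
      \<Longrightarrow> osum F (\<sigma> s) (\<sigma> t) = Some (\<sigma> r)"
    and sharp_unit: "\<sigma> (ounit E) = ounit F"
    and meager_image: "m \<in> meager_elems E \<Longrightarrow> \<mu> m \<in> meager_elems F"
    and meager_sum: "\<lbrakk>osum E m n = Some k; k \<in> meager_elems E\<rbrakk> \<Longrightarrow> osum F (\<mu> m) (\<mu> n) = Some (\<mu> k)"
    and meager_le: "\<lbrakk>m \<in> meager_elems E; s \<in> sharp_elems E; ole E m s\<rbrakk> \<Longrightarrow> ole F (\<mu> m) (\<sigma> s)"
begin

lemma meager_mono: "ole E x y \<Longrightarrow> y \<in> meager_elems E \<Longrightarrow> ole F (\<mu> x) (\<mu> y)"
  unfolding ole_def using meager_sum by blast

lemma sharp_mono:
  assumes "ole E s t" "s \<in> sharp_elems E" "t \<in> sharp_elems E"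
  shows "ole F (\<sigma> s) (\<sigma> t)"
proof -
  obtain d where d: "osum E s d = Some t" using assms(1) ole_def by metis
  show ?thesis
    using sharp_sum[OF assms(2) _ d] E.sharp_diff[OF E.homogeneous assms(2,3) d] ole_def by metis
qed

definition glue :: "'a \<Rightarrow> 'b" where
  "glue x = (let s = sharp_kernel E x in the (osum F (\<sigma> s) (\<mu> (THE m. osum E s m = Some x))))"

text \<open>Definedness comes from \<open>h\<close>: \<open>m\<close> lies below the complement of
  \<open>s\<close>, so \<open>meager_le\<close> puts \<open>\<mu> m\<close> below the complement of
  \<open>\<sigma> s\<close>.\<close>

lemma glue_eq:
  assumes s: "s \<in> sharp_elems E" and m: "m \<in> meager_elems E" and x: "osum E s m = Some x"
  shows "osum F (\<sigma> s) (\<mu> m) = Some (glue x)"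
proof -
  have "osum E s (ocompl E s) = Some (ounit E)" using E.osum_ocompl E.sharp_closed[OF s] by blast
  then have "osum F (\<sigma> s) (\<sigma> (ocompl E s)) = Some (ounit F)"
    using sharp_sum s E.sharp_ocompl[OF s] sharp_unit by metis
  then have "\<sigma> (ocompl E s) = ocompl F (\<sigma> s)"
    using F.compl_unique F.osum_ocompl F.osum_closed by blast
  moreover have "ole E m (ocompl E s)" using E.osum_ole_ocompl x E.commute by metis
  ultimately have "ole F (\<mu> m) (ocompl F (\<sigma> s))"
    using meager_le[OF m E.sharp_ocompl[OF s]] by simp
  then obtain y where "osum F (\<mu> m) (\<sigma> s) = Some y"
    using F.ole_ocompl_osum F.sharp_closed[OF sharp_image[OF s]] by blast
  then have y: "osum F (\<sigma> s) (\<mu> m) = Some y" using F.commute by simp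
  have "sharp_kernel E x = s"
    using E.sharp_meager_kernel[OF E.homogeneous s m x E.sharply_dominating] .
  moreover have "(THE m. osum E s m = Some x) = m" using x E.cancel by blast
  ultimately show ?thesis using y by (simp add: glue_def)
qed

end

section \<open>Transport along an isomorphism of triples\<close>

locale triple_iso = triple_map E F \<sigma> \<mu> + inv: triple_map F E \<sigma>' \<mu>'
  for E :: "'a ealg" and F :: "'b ealg" and \<sigma> \<mu> \<sigma>' \<mu>' +
  assumes sharp_inv: "s \<in> sharp_elems E \<Longrightarrow> \<sigma>' (\<sigma> s) = s" "t \<in> sharp_elems F \<Longrightarrow> \<sigma> (\<sigma>' t) = t"
    and meager_inv: "m \<in> meager_elems E \<Longrightarrow> \<mu>' (\<mu> m) = m" "n \<in> meager_elems F \<Longrightarrow> \<mu> (\<mu>' n) = n"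
begin

lemma triple_iso_sym: "triple_iso F E \<sigma>' \<mu>' \<sigma> \<mu>"
  by unfold_locales (fact sharp_inv meager_inv)+

lemma meager_le_iff:
  assumes "x \<in> meager_elems E" "y \<in> meager_elems E"
  shows "ole F (\<mu> x) (\<mu> y) \<longleftrightarrow> ole E x y"
  using meager_mono inv.meager_mono meager_image meager_inv assms by metis

lemma below_iff:
  assumes "m \<in> meager_elems E" "s \<in> sharp_elems E"
  shows "\<mu> m \<in> meager_below F (\<sigma> s) \<longleftrightarrow> m \<in> meager_below E s"
proof -
  have "ole F (\<mu> m) (\<sigma> s) \<longleftrightarrow> ole E m s"
    using meager_le inv.meager_le meager_image sharp_image meager_inv sharp_inv assms by metis
  then show ?thesis using assms meager_image by (simp add: meager_below_def)
qed

lemma meager_sum_eq: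
  assumes "a \<in> meager_elems E" "b \<in> meager_elems E" "c \<in> meager_elems E"
  shows "osum (meager_alg F) (\<mu> a) (\<mu> b) = Some (\<mu> c) \<longleftrightarrow> osum (meager_alg E) a b = Some c"
proof
  assume "osum (meager_alg F) (\<mu> a) (\<mu> b) = Some (\<mu> c)"
  then have "osum E (\<mu>' (\<mu> a)) (\<mu>' (\<mu> b)) = Some (\<mu>' (\<mu> c))"
    using inv.meager_sum F.meager_sum_iff by blast
  then show "osum (meager_alg E) a b = Some c"
    using meager_inv(1) assms by (simp add: E.meager_sum_iff)
next
  assume "osum (meager_alg E) a b = Some c"
  then show "osum (meager_alg F) (\<mu> a) (\<mu> b) = Some (\<mu> c)"
    using meager_sum meager_image[OF assms(3)] by (simp add: E.meager_sum_iff F.meager_sum_iff)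
qed

lemma ex_meager: "(\<exists>y\<in>meager_elems F. P y) \<longleftrightarrow> (\<exists>x\<in>meager_elems E. P (\<mu> x))"
  using meager_image inv.meager_image meager_inv(2) by metis

text \<open>\<open>h\<close> records which sharp elements dominate a meager one, and \<sigma>
  preserves the order among them.\<close>

lemma cover_eq:
  assumes x: "x \<in> meager_elems E"
  shows "sharp_cover F (\<mu> x) = \<sigma> (sharp_cover E x)"
proof -
  have c: "is_sharp_cover E x (sharp_cover E x)" using E.sharp_cover_is E.meager_closed x by blast
  have "ole F (\<sigma> (sharp_cover E x)) t" if t: "t \<in> sharp_elems F" "ole F (\<mu> x) t" for t
  proof -
    have "ole E x (\<sigma>' t)" using inv.meager_le[OF meager_image[OF x] t] meager_inv(1)[OF x] by simp
    then have "ole E (sharp_cover E x) (\<sigma>' t)"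
      using c inv.sharp_image[OF t(1)] unfolding is_sharp_cover_def by blast
    then show ?thesis
      using sharp_mono c inv.sharp_image[OF t(1)] sharp_inv(2)[OF t(1)]
      unfolding is_sharp_cover_def by metis
  qed
  then have "is_sharp_cover F (\<mu> x) (\<sigma> (sharp_cover E x))"
    using c sharp_image meager_le[OF x] unfolding is_sharp_cover_def by blast
  then show ?thesis by (rule F.sharp_cover_eqI)
qed

lemma cover_eq_iff:
  assumes "x \<in> meager_elems E" "y \<in> meager_elems E"
  shows "sharp_cover F (\<mu> x) = sharp_cover F (\<mu> y) \<longleftrightarrow> sharp_cover E x = sharp_cover E y"
proof -
  have "sharp_cover E x \<in> sharp_elems E" "sharp_cover E y \<in> sharp_elems E"
    using E.sharp_cover_is E.meager_closed assms unfolding is_sharp_cover_def by blast+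
  then show ?thesis using cover_eq assms sharp_inv(1) by metis
qed

lemma sum_below_iff:
  assumes z: "z \<in> meager_elems E" and x: "x \<in> meager_elems E" and s: "s \<in> sharp_elems E"
  shows "(\<exists>w. osum (meager_alg F) (\<mu> z) (\<mu> x) = Some w \<and> w \<in> meager_below F (\<sigma> s)) \<longleftrightarrow>
    (\<exists>w. osum (meager_alg E) z x = Some w \<and> w \<in> meager_below E s)"
proof -
  have "(\<exists>w. osum (meager_alg F) (\<mu> z) (\<mu> x) = Some w \<and> w \<in> meager_below F (\<sigma> s)) \<longleftrightarrow>
      (\<exists>w\<in>meager_elems F. osum (meager_alg F) (\<mu> z) (\<mu> x) = Some w \<and> w \<in> meager_below F (\<sigma> s))"
    by (auto simp: meager_below_def)
  also have "\<dots> \<longleftrightarrow> (\<exists>w\<in>meager_elems E. osum (meager_alg E) z x = Some w \<and> w \<in> meager_below E s)"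
    unfolding ex_meager using meager_sum_eq[OF z x] below_iff[OF _ s] by blast
  finally show ?thesis by (auto simp: meager_below_def)
qed

lemma meager_diff:
  assumes "is_odiff (meager_alg E) y z d"
  shows "z \<in> meager_elems E \<and> d \<in> meager_elems E"
  using assms E.meager_down E.ole_osum unfolding is_odiff_def E.meager_sum_iff by blast

lemma diff_cover_iff:
  assumes x: "x \<in> meager_elems E" and y: "y \<in> meager_elems E" and z: "z \<in> meager_elems E"
  shows "(\<exists>d. is_odiff (meager_alg F) (\<mu> y) (\<mu> z) d \<and> sharp_cover F d = sharp_cover F (\<mu> x)) \<longleftrightarrow>
    (\<exists>d. is_odiff (meager_alg E) y z d \<and> sharp_cover E d = sharp_cover E x)"
proof -
  interpret sym: triple_iso F E \<sigma>' \<mu>' \<sigma> \<mu> by (rule triple_iso_sym)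
  have "(\<exists>d. is_odiff (meager_alg F) (\<mu> y) (\<mu> z) d \<and> sharp_cover F d = sharp_cover F (\<mu> x)) \<longleftrightarrow>
      (\<exists>d\<in>meager_elems F. is_odiff (meager_alg F) (\<mu> y) (\<mu> z) d \<and> sharp_cover F d = sharp_cover F (\<mu> x))"
    using sym.meager_diff by blast
  also have "\<dots> \<longleftrightarrow> (\<exists>d\<in>meager_elems E. is_odiff (meager_alg E) y z d \<and> sharp_cover E d = sharp_cover E x)"
    unfolding ex_meager is_odiff_def using meager_sum_eq[OF z _ y] cover_eq_iff[OF _ x] by blast
  finally show ?thesis using meager_diff by blast
qed

text \<open>Meets are taken in the whole algebra, but lower bounds of meager elements are meager and
  hence in the range of \<mu>.\<close>

lemma omeet_image:
  assumes x: "x \<in> meager_elems E" and y: "y \<in> meager_elems E" and m: "is_omeet E x y m"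
  shows "is_omeet F (\<mu> x) (\<mu> y) (\<mu> m)"
  unfolding is_omeet_def
proof (intro conjI allI impI)
  have le: "ole E m x" "ole E m y" and mM: "m \<in> meager_elems E"
    using m E.meager_down[OF x] unfolding is_omeet_def by blast+
  show "ole F (\<mu> m) (\<mu> x)" "ole F (\<mu> m) (\<mu> y)" using meager_mono le x y by blast+
  fix w assume w: "ole F w (\<mu> x) \<and> ole F w (\<mu> y)"
  then have wM: "w \<in> meager_elems F" using F.meager_down meager_image[OF x] by blast
  have "ole E (\<mu>' w) x" "ole E (\<mu>' w) y"
    using w meager_le_iff[OF inv.meager_image[OF wM]] meager_inv(2)[OF wM] x y by simp_all
  then have "ole E (\<mu>' w) m" using m unfolding is_omeet_def by blast
  then show "ole F w (\<mu> m)" using meager_mono mM meager_inv(2)[OF wM] by metis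
qed

text \<open>Every ingredient is read off from meager elements, their order and sums, covers and
  \<open>h\<close>. The equivalence in the last clause needs these to be reflected as well as
  preserved.\<close>

lemma trt_condition_image:
  assumes x: "x \<in> meager_elems E" and trt: "trt_condition E x y"
  shows "trt_condition F (\<mu> x) (\<mu> y)"
proof -
  have y: "y \<in> meager_elems E" "sharp_cover E y = sharp_cover E x"
    using trt unfolding trt_condition_def by blast+
  have s: "sharp_cover E x \<in> sharp_elems E"
    using E.sharp_cover_is E.meager_closed x unfolding is_sharp_cover_def by blast
  have cx: "sharp_cover F (\<mu> x) = \<sigma> (sharp_cover E x)" by (rule cover_eq[OF x])
  obtain m d w where mdw: "is_omeet E x y m" "is_odiff (meager_alg E) y m d"
      "osum (meager_alg E) x d = Some w" "w \<in> meager_below E (sharp_cover E x)"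
    using trt unfolding trt_condition_def by blast
  have M: "m \<in> meager_elems E" "d \<in> meager_elems E" using meager_diff[OF mdw(2)] by auto
  have "is_odiff (meager_alg F) (\<mu> y) (\<mu> m) (\<mu> d)"
    using mdw(2) meager_sum_eq M y(1) unfolding is_odiff_def by blast
  moreover have "\<exists>w. osum (meager_alg F) (\<mu> x) (\<mu> d) = Some w \<and> w \<in> meager_below F (sharp_cover F (\<mu> x))"
    unfolding cx sum_below_iff[OF x M(2) s] using mdw(3,4) by blast
  ultimately have ii: "\<exists>m d w. is_omeet F (\<mu> x) (\<mu> y) m \<and> is_odiff (meager_alg F) (\<mu> y) m d \<and>
      osum (meager_alg F) (\<mu> x) d = Some w \<and> w \<in> meager_below F (sharp_cover F (\<mu> x))"
    using omeet_image[OF x y(1) mdw(1)] by blast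
  have iii: "(\<exists>w. osum (meager_alg F) z (\<mu> x) = Some w \<and> w \<in> meager_below F (sharp_cover F (\<mu> x))) \<longleftrightarrow>
      (ole F z (\<mu> y) \<and> (\<exists>d. is_odiff (meager_alg F) (\<mu> y) z d \<and> sharp_cover F d = sharp_cover F (\<mu> x)))"
    if z: "z \<in> meager_below F (sharp_cover F (\<mu> x))" for z
  proof -
    have zM: "z \<in> meager_elems F" using z by (simp add: meager_below_def)
    define u where "u = \<mu>' z"
    have u: "u \<in> meager_elems E" "z = \<mu> u"
      using inv.meager_image[OF zM] meager_inv(2)[OF zM] by (simp_all add: u_def)
    have "u \<in> meager_below E (sharp_cover E x)" using z u cx below_iff[OF u(1) s] by simp
    then have "(\<exists>w. osum (meager_alg E) u x = Some w \<and> w \<in> meager_below E (sharp_cover E x)) \<longleftrightarrow>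
        (ole E u y \<and> (\<exists>d. is_odiff (meager_alg E) y u d \<and> sharp_cover E d = sharp_cover E x))"
      using trt unfolding trt_condition_def by blast
    then show ?thesis
      unfolding u(2) diff_cover_iff[OF x y(1) u(1)] meager_le_iff[OF u(1) y(1)]
      unfolding cx sum_below_iff[OF u(1) x s] .
  qed
  show ?thesis unfolding trt_condition_def
    using meager_image[OF y(1)] cover_eq_iff[OF y(1) x] y(2) ii iii by blast
qed

text \<open>Uniqueness is applied in \<open>F\<close>: \<open>\<mu> n\<close> meets the condition
  for \<open>\<mu> m\<close>, so it must be the cover of \<open>\<mu> m\<close> minus
  \<open>\<mu> m\<close>.\<close>

lemma meager_split_sharp_image:
  assumes m: "m \<in> meager_elems E" and n: "n \<in> meager_elems E" and v: "v \<in> sharp_elems E"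
    and sum: "osum E m n = Some v"
  shows "osum F (\<mu> m) (\<mu> n) = Some (\<sigma> v)"
proof -
  have c: "sharp_cover E m = v" "trt_condition E m n" using E.meager_split_sharp[OF assms] .
  obtain y where y: "is_odiff F (sharp_cover F (\<mu> m)) (\<mu> m) y"
      "\<forall>w\<in>carrier F. trt_condition F (\<mu> m) w \<longrightarrow> w = y"
    using F.trt[OF meager_image[OF m]] by blast
  then have "\<mu> n = y"
    using trt_condition_image[OF m c(2)] F.meager_closed[OF meager_image[OF n]] by blast
  then show ?thesis using y(1) cover_eq[OF m] c(1) by (simp add: is_odiff_def)
qed

lemma meager_sum_image:
  assumes m: "m \<in> meager_elems E" and n: "n \<in> meager_elems E" and r: "osum E m n = Some r"
    and v: "v \<in> sharp_elems E" and k: "k \<in> meager_elems E" and vk: "osum E v k = Some r"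
  obtains q where "osum F (\<mu> m) (\<mu> n) = Some q" "osum F (\<sigma> v) (\<mu> k) = Some q"
proof -
  obtain v' k' m1 m2 n1 n2 where d: "v' \<in> sharp_elems E" "k' \<in> meager_elems E" "osum E v' k' = Some r"
      "osum E m1 m2 = Some m" "osum E n1 n2 = Some n" "osum E m1 n1 = Some v'" "osum E m2 n2 = Some k'"
    using E.meager_sum_decomposition[OF m n r] .
  have "v' = v"
    using E.sharp_meager_kernel[OF E.homogeneous _ _ _ E.sharply_dominating] d(1-3) v k vk by metis
  moreover from this have "k' = k" using E.cancel d(3) vk by blast
  ultimately have d': "osum E m1 n1 = Some v" "osum E m2 n2 = Some k" using d by simp_all
  have M: "m1 \<in> meager_elems E" "n1 \<in> meager_elems E"
    using E.meager_down m n E.ole_osum(1) d(4,5) by blast+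
  \<comment> \<open>The interchange starts from \<open>glue r\<close>, known to exist as
    \<open>\<sigma> v + \<mu> k\<close>, and so also yields that \<open>\<mu> m + \<mu> n\<close> is
    defined.\<close>
  obtain x y where "osum F (\<mu> m1) (\<mu> m2) = Some x" "osum F (\<mu> n1) (\<mu> n2) = Some y"
      "osum F x y = Some (glue r)"
    using F.osum_interchange[OF meager_split_sharp_image[OF M v d'(1)] meager_sum[OF d'(2) k]
        glue_eq[OF v k vk]] .
  then have "osum F (\<mu> m) (\<mu> n) = Some (glue r)"
    using meager_sum[OF d(4) m] meager_sum[OF d(5) n] by simp
  then show ?thesis using that glue_eq[OF v k vk] by blast
qed

text \<open>The sum of the meager parts may acquire a sharp part \<open>v\<close>, which is moved
  over to \<open>u = s + t\<close>; in \<open>F\<close> this move is undone.\<close>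

lemma glue_osum:
  assumes xy: "osum E x y = Some z"
  shows "osum F (glue x) (glue y) = Some (glue z)"
proof -
  note decomp = E.sharp_meager_decomposition[OF E.homogeneous E.sharply_dominating]
  have c: "x \<in> carrier E" "y \<in> carrier E" using E.osum_closed[OF xy] by auto
  obtain s m where s: "s \<in> sharp_elems E" "m \<in> meager_elems E" "osum E s m = Some x" using decomp[OF c(1)] .
  obtain t n where t: "t \<in> sharp_elems E" "n \<in> meager_elems E" "osum E t n = Some y" using decomp[OF c(2)] .
  obtain u r where u: "osum E s t = Some u" "osum E m n = Some r" "osum E u r = Some z"
    using E.osum_interchange[OF s(3) t(3) xy] .
  have uS: "u \<in> sharp_elems E" using E.sharp_osum[OF E.homogeneous s(1) t(1) u(1)] .
  have "r \<in> carrier E" using E.osum_closed[OF u(2)] by blast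
  then obtain v k where v: "v \<in> sharp_elems E" "k \<in> meager_elems E" "osum E v k = Some r"
    using decomp by blast
  obtain w where w: "osum E u v = Some w" "osum E w k = Some z" using E.assocD2[OF v(3) u(3)] .
  have wS: "w \<in> sharp_elems E" using E.sharp_osum[OF E.homogeneous uS v(1) w(1)] .
  obtain q where q: "osum F (\<mu> m) (\<mu> n) = Some q" "osum F (\<sigma> v) (\<mu> k) = Some q"
    using meager_sum_image[OF s(2) t(2) u(2) v] .
  \<comment> \<open>\<open>q\<close> is both \<open>\<sigma> v + \<mu> k\<close> and
    \<open>\<mu> m + \<mu> n\<close>, so the sharp surplus is exchanged for the two meager
    images.\<close>
  have "osum F (\<sigma> u) q = Some (glue z)"
    using F.assocD1[OF sharp_sum[OF uS v(1) w(1)] glue_eq[OF wS v(2) w(2)]] q(2) by auto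
  then obtain a b where "osum F (\<sigma> s) (\<mu> m) = Some a" "osum F (\<sigma> t) (\<mu> n) = Some b"
      "osum F a b = Some (glue z)"
    using F.osum_interchange[OF sharp_sum[OF s(1) t(1) u(1)] q(1)] by blast
  then show ?thesis using glue_eq[OF s] glue_eq[OF t] by simp
qed

lemma glue_inv:
  assumes "x \<in> carrier E"
  shows "inv.glue (glue x) = x"
proof -
  obtain s m where s: "s \<in> sharp_elems E" "m \<in> meager_elems E" "osum E s m = Some x"
    using E.sharp_meager_decomposition[OF E.homogeneous E.sharply_dominating assms] .
  have "osum E (\<sigma>' (\<sigma> s)) (\<mu>' (\<mu> m)) = Some (inv.glue (glue x))"
    using inv.glue_eq[OF sharp_image[OF s(1)] meager_image[OF s(2)] glue_eq[OF s]] .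
  then show ?thesis using s sharp_inv(1) meager_inv(1) by simp
qed

lemma glue_morphism: "ea_morphism E F glue"
proof -
  have zM: "ozero E \<in> meager_elems E"
    using E.zero_closed E.ole_zero by (simp add: meager_elems_def)
  have "osum E (ozero E) (ozero E) = Some (ozero E)" using E.osum_zero E.zero_closed by blast
  then have "osum F (\<mu> (ozero E)) (\<mu> (ozero E)) = Some (\<mu> (ozero E))" using meager_sum zM by blast
  then have "\<mu> (ozero E) = ozero F"
    using F.cancel F.osum_zero F.osum_closed by blast
  then have "osum F (ounit F) (ozero F) = Some (glue (ounit E))"
    using glue_eq[OF E.unit_sharp zM E.unit_osum_zero] sharp_unit by simp
  then have "glue (ounit E) = ounit F" using F.unit_osum_zero by simp
  moreover have "glue x \<in> carrier F" if "x \<in> carrier E" for x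
    using glue_osum[OF E.osum_ocompl[OF that]] F.osum_closed by blast
  ultimately show ?thesis unfolding ea_morphism_def using glue_osum by blast
qed

lemma glue_isomorphism: "ea_isomorphism E F glue"
proof -
  interpret sym: triple_iso F E \<sigma>' \<mu>' \<sigma> \<mu> by (rule triple_iso_sym)
  have img: "glue ` carrier E \<subseteq> carrier F" "inv.glue ` carrier F \<subseteq> carrier E"
    using glue_morphism sym.glue_morphism unfolding ea_morphism_def by auto
  have bij: "bij_betw glue (carrier E) (carrier F)"
    by (rule bij_betw_byWitness[of _ inv.glue]) (use glue_inv sym.glue_inv img in auto)
  have eq: "inv_into (carrier E) glue y = inv.glue y" if "y \<in> carrier F" for y
    using that bij img sym.glue_inv
    by (metis bij_betw_imp_inj_on image_subset_iff inv_into_f_eq)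
  have "ea_morphism F E (inv_into (carrier E) glue)"
    using sym.glue_morphism img(2) F.osum_closed F.unit_closed
    unfolding ea_morphism_def by (auto simp: eq)
  then show ?thesis using bij glue_morphism by (simp add: ea_isomorphism_def)
qed

end

section \<open>From isomorphic algebras to isomorphic triples\<close>

text \<open>Stated for records with closed operations, so that it applies to
  \<open>sharp_alg\<close> directly.\<close>

lemma ea_isomorphismI:
  assumes bij: "bij_betw f (carrier E) (carrier F)" and unit: "f (ounit E) = ounit F" "ounit E \<in> carrier E"
    and E: "\<And>x y z. osum E x y = Some z \<Longrightarrow> x \<in> carrier E \<and> y \<in> carrier E \<and> z \<in> carrier E"
    and F: "\<And>x y z. osum F x y = Some z \<Longrightarrow> x \<in> carrier F \<and> y \<in> carrier F \<and> z \<in> carrier F"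
    and sum: "\<And>x y z. \<lbrakk>x \<in> carrier E; y \<in> carrier E; z \<in> carrier E\<rbrakk> \<Longrightarrow>
      osum F (f x) (f y) = Some (f z) \<longleftrightarrow> osum E x y = Some z"
  shows "ea_isomorphism E F f"
proof -
  let ?g = "inv_into (carrier E) f"
  have "ea_morphism E F f"
    using bij unit E sum unfolding ea_morphism_def bij_betw_def by blast
  moreover have "ea_morphism F E ?g"
    unfolding ea_morphism_def
  proof (intro conjI allI impI)
    show "?g ` carrier F \<subseteq> carrier E" using bij_betw_inv_into[OF bij] by (simp add: bij_betw_def)
    show "?g (ounit F) = ounit E" using bij_betw_inv_into_left[OF bij unit(2)] unit(1) by simp
    fix x y z assume s: "osum F x y = Some z"
    then have c: "x \<in> carrier F" "y \<in> carrier F" "z \<in> carrier F" using F by blast+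
    then have "?g x \<in> carrier E" "?g y \<in> carrier E" "?g z \<in> carrier E"
      using bij_betw_inv_into[OF bij] bij_betwE by blast+
    then show "osum E (?g x) (?g y) = Some (?g z)"
      using sum s c bij_betw_inv_into_right[OF bij] by metis
  qed
  ultimately show ?thesis using bij by (simp add: ea_isomorphism_def)
qed

locale ea_iso = E: effect_algebra E + F: effect_algebra F
  for E :: "'a ealg" and F :: "'b ealg" +
  fixes f
  assumes iso: "ea_isomorphism E F f"
begin

lemma bij: "bij_betw f (carrier E) (carrier F)"
  using iso by (simp add: ea_isomorphism_def)

lemma image_closed: "x \<in> carrier E \<Longrightarrow> f x \<in> carrier F"
  using bij bij_betwE by blast

lemma carrierE: 
  assumes "y \<in> carrier F"
  obtains x where "x \<in> carrier E" "f x = y"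
  using assms bij by (metis bij_betw_imp_surj_on imageE)

lemma eq_iff: "x \<in> carrier E \<Longrightarrow> y \<in> carrier E \<Longrightarrow> f x = f y \<longleftrightarrow> x = y"
  using bij by (auto simp: bij_betw_def inj_on_def)

lemma unit_image: "f (ounit E) = ounit F"
  using iso by (simp add: ea_isomorphism_def ea_morphism_def)

lemma osum_image_iff:
  assumes "x \<in> carrier E" "y \<in> carrier E" "z \<in> carrier E"
  shows "osum F (f x) (f y) = Some (f z) \<longleftrightarrow> osum E x y = Some z"
  using iso assms bij_betw_inv_into_left[OF bij]
  unfolding ea_isomorphism_def ea_morphism_def by metis

lemma zero_image: "f (ozero E) = ozero F"
proof -
  have "osum F (f (ozero E)) (f (ozero E)) = Some (f (ozero E))"
    using osum_image_iff E.osum_zero E.zero_closed by blast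
  then show ?thesis using F.cancel F.osum_zero image_closed[OF E.zero_closed] by blast
qed

lemma ole_image_iff:
  assumes "x \<in> carrier E" "y \<in> carrier E"
  shows "ole F (f x) (f y) \<longleftrightarrow> ole E x y"
proof
  assume "ole F (f x) (f y)"
  then obtain w where w: "osum F (f x) w = Some (f y)" using ole_def by metis
  then obtain z where "z \<in> carrier E" "f z = w" using carrierE F.osum_closed by blast
  then show "ole E x y" using w osum_image_iff assms ole_def by metis
next
  assume "ole E x y"
  then obtain z where "osum E x z = Some y" using ole_def by metis
  then show "ole F (f x) (f y)" using osum_image_iff E.osum_closed ole_def by metis
qed

lemma ocompl_image:
  assumes "x \<in> carrier E"
  shows "ocompl F (f x) = f (ocompl E x)"
proof -
  have "osum F (f x) (f (ocompl E x)) = Some (ounit F)"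
    using osum_image_iff[of x "ocompl E x" "ounit E"] E.osum_ocompl assms E.ocompl_closed
      E.unit_closed unit_image by simp
  then show ?thesis using F.compl_unique F.osum_ocompl image_closed[OF assms] by blast
qed

lemma sharp_image_iff:
  assumes x: "x \<in> carrier E"
  shows "f x \<in> sharp_elems F \<longleftrightarrow> x \<in> sharp_elems E"
proof -
  have eq: "(ole F (f u) (f x) \<and> ole F (f u) (ocompl F (f x)) \<longrightarrow> f u = ozero F) \<longleftrightarrow>
      (ole E u x \<and> ole E u (ocompl E x) \<longrightarrow> u = ozero E)" if "u \<in> carrier E" for u
    unfolding ocompl_image[OF x] zero_image[symmetric]
    using that x ole_image_iff E.ocompl_closed eq_iff[OF _ E.zero_closed] by simp
  \<comment> \<open>Elements below \<open>f x\<close> lie in the carrier, which is the image of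
    \<open>f\<close>, so the quantifier can be pulled back.\<close>
  have "(\<forall>u. ole F u (f x) \<and> ole F u (ocompl F (f x)) \<longrightarrow> u = ozero F) \<longleftrightarrow>
      (\<forall>u\<in>f ` carrier E. ole F u (f x) \<and> ole F u (ocompl F (f x)) \<longrightarrow> u = ozero F)"
    unfolding bij_betw_imp_surj_on[OF bij] using F.ole_carrier by blast
  also have "\<dots> \<longleftrightarrow>
      (\<forall>u\<in>carrier E. ole F (f u) (f x) \<and> ole F (f u) (ocompl F (f x)) \<longrightarrow> f u = ozero F)"
    by simp
  also have "\<dots> \<longleftrightarrow> (\<forall>u. ole E u x \<and> ole E u (ocompl E x) \<longrightarrow> u = ozero E)"
    using eq E.ole_carrier by blast
  finally show ?thesis using x image_closed by (simp add: E.sharp_iff F.sharp_iff)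
qed

lemma sharp_image: "f ` sharp_elems E = sharp_elems F"
proof (intro equalityI subsetI)
  show "y \<in> sharp_elems F" if "y \<in> f ` sharp_elems E" for y
    using that sharp_image_iff E.sharp_closed by blast
  show "y \<in> f ` sharp_elems E" if y: "y \<in> sharp_elems F" for y
  proof -
    obtain x where "x \<in> carrier E" "f x = y" using carrierE F.sharp_closed[OF y] .
    then show ?thesis using sharp_image_iff y by blast
  qed
qed

lemma meager_image_iff:
  assumes x: "x \<in> carrier E"
  shows "f x \<in> meager_elems F \<longleftrightarrow> x \<in> meager_elems E"
proof -
  have "(\<forall>v\<in>sharp_elems F. ole F v (f x) \<longrightarrow> v = ozero F) \<longleftrightarrow>
      (\<forall>v\<in>sharp_elems E. ole F (f v) (f x) \<longrightarrow> f v = f (ozero E))"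
    unfolding sharp_image[symmetric] zero_image by blast
  also have "\<dots> \<longleftrightarrow> (\<forall>v\<in>sharp_elems E. ole E v x \<longrightarrow> v = ozero E)"
    using ole_image_iff[OF _ x] eq_iff[OF _ E.zero_closed] E.sharp_closed by blast
  finally show ?thesis using x image_closed by (simp add: meager_elems_def)
qed

lemma meager_image: "f ` meager_elems E = meager_elems F"
proof (intro equalityI subsetI)
  show "y \<in> meager_elems F" if "y \<in> f ` meager_elems E" for y
    using that meager_image_iff E.meager_closed by blast
  show "y \<in> f ` meager_elems E" if y: "y \<in> meager_elems F" for y
  proof -
    obtain x where "x \<in> carrier E" "f x = y" using carrierE F.meager_closed[OF y] .
    then show ?thesis using meager_image_iff y by blast
  qed
qed

lemma bij_subset: "A \<subseteq> carrier E \<Longrightarrow> f ` A = B \<Longrightarrow> bij_betw f A B"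
  using bij bij_betw_subset by blast

lemma sharp_isomorphism: "ea_isomorphism (sharp_alg E) (sharp_alg F) f"
proof (rule ea_isomorphismI)
  show "bij_betw f (carrier (sharp_alg E)) (carrier (sharp_alg F))"
    using bij_subset[OF _ sharp_image] E.sharp_closed by (auto simp: sharp_alg_def sub_ealg_def)
  fix x y z
  assume "x \<in> carrier (sharp_alg E)" "y \<in> carrier (sharp_alg E)" "z \<in> carrier (sharp_alg E)"
  then show "osum (sharp_alg F) (f x) (f y) = Some (f z) \<longleftrightarrow> osum (sharp_alg E) x y = Some z"
    using osum_image_iff sharp_image E.sharp_closed
    by (auto simp: sharp_alg_def sub_ealg_def E.osum_on_Some F.osum_on_Some)
qed (auto simp: sharp_alg_def sub_ealg_def E.osum_on_Some F.osum_on_Some unit_image E.unit_sharp)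

lemma meager_isomorphism: "gea_isomorphism (meager_alg E) (meager_alg F) f"
  unfolding gea_isomorphism_def
proof (intro conjI ballI)
  show "bij_betw f (carrier (meager_alg E)) (carrier (meager_alg F))"
    using bij_subset[OF _ meager_image] E.meager_closed by (auto simp: meager_alg_def)
  show "f (ozero (meager_alg E)) = ozero (meager_alg F)" by (simp add: meager_alg_def zero_image)
  fix x y assume "x \<in> carrier (meager_alg E)" "y \<in> carrier (meager_alg E)"
  then have M: "x \<in> meager_elems E" "y \<in> meager_elems E" by (simp_all add: meager_alg_def)
  have eq: "osum (meager_alg F) (f x) (f y) = Some (f z) \<longleftrightarrow> osum (meager_alg E) x y = Some z"
    if "z \<in> meager_elems E" for z
    using that M osum_image_iff meager_image E.meager_closed
    by (auto simp: meager_alg_def E.osum_on_Some F.osum_on_Some)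
  have "osum (meager_alg F) (f x) (f y) = Some w \<longleftrightarrow> map_option f (osum (meager_alg E) x y) = Some w" for w
  proof
    assume w: "osum (meager_alg F) (f x) (f y) = Some w"
    then have "w \<in> meager_elems F" by (simp add: meager_alg_def F.osum_on_Some)
    then obtain z where z: "z \<in> meager_elems E" "w = f z" using meager_image by blast
    then have "osum (meager_alg E) x y = Some z" using eq w by blast
    then show "map_option f (osum (meager_alg E) x y) = Some w" using z(2) by simp
  next
    assume "map_option f (osum (meager_alg E) x y) = Some w"
    then obtain z where z: "osum (meager_alg E) x y = Some z" "w = f z" by auto
    then have "z \<in> meager_elems E" by (simp add: meager_alg_def E.osum_on_Some)
    then show "osum (meager_alg F) (f x) (f y) = Some w" using eq z by simp
  qed
  then show "osum (meager_alg F) (f x) (f y) = map_option f (osum (meager_alg E) x y)"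
    by (metis not_None_eq)
qed

lemma meager_below_image:
  assumes s: "s \<in> sharp_elems E"
  shows "f ` meager_below E s = meager_below F (f s)"
proof -
  have "ole F (f m) (f s) \<longleftrightarrow> ole E m s" if "m \<in> meager_elems E" for m
    using ole_image_iff E.meager_closed[OF that] E.sharp_closed[OF s] .
  then show ?thesis unfolding meager_below_def meager_image[symmetric] by blast
qed

end

section \<open>The equivalence\<close>

text \<open>Equality of the sets in \<open>h\<close>, rather than inclusion, provides
  \<open>meager_le\<close> for the inverse maps.\<close>

lemma triple_isoI:
  fixes E :: "'a ealg" and F :: "'b ealg"
  assumes E: "trt_effect_algebra E" and F: "trt_effect_algebra F"
    and \<sigma>: "ea_isomorphism (sharp_alg E) (sharp_alg F) \<sigma>"
    and \<mu>: "gea_isomorphism (meager_alg E) (meager_alg F) \<mu>"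
    and h: "\<forall>s\<in>sharp_elems E. \<mu> ` meager_below E s = meager_below F (\<sigma> s)"
  shows "triple_iso E F \<sigma> \<mu> (inv_into (sharp_elems E) \<sigma>) (inv_into (meager_elems E) \<mu>)"
proof -
  interpret E: trt_effect_algebra E by (rule E)
  interpret F: trt_effect_algebra F by (rule F)
  let ?\<sigma>' = "inv_into (sharp_elems E) \<sigma>" and ?\<mu>' = "inv_into (meager_elems E) \<mu>"
  have bs: "bij_betw \<sigma> (sharp_elems E) (sharp_elems F)"
    using \<sigma> by (simp add: ea_isomorphism_def sharp_alg_def sub_ealg_def)
  have bm: "bij_betw \<mu> (meager_elems E) (meager_elems F)"
    using \<mu> by (simp add: gea_isomorphism_def meager_alg_def)
  note s_inv = bij_betw_inv_into_left[OF bs] bij_betw_inv_into_right[OF bs]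
  note m_inv = bij_betw_inv_into_left[OF bm] bij_betw_inv_into_right[OF bm]
  have s_img: "\<And>s. s \<in> sharp_elems E \<Longrightarrow> \<sigma> s \<in> sharp_elems F"
      "\<And>s. s \<in> sharp_elems F \<Longrightarrow> ?\<sigma>' s \<in> sharp_elems E"
    using bs bij_betw_inv_into[OF bs] bij_betwE by blast+
  have m_img: "\<And>m. m \<in> meager_elems E \<Longrightarrow> \<mu> m \<in> meager_elems F"
      "\<And>m. m \<in> meager_elems F \<Longrightarrow> ?\<mu>' m \<in> meager_elems E"
    using bm bij_betw_inv_into[OF bm] bij_betwE by blast+
  have mor: "ea_morphism (sharp_alg E) (sharp_alg F) \<sigma>" "ea_morphism (sharp_alg F) (sharp_alg E) ?\<sigma>'"
    using \<sigma> by (simp_all add: ea_isomorphism_def sharp_alg_def sub_ealg_def)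
  have unit: "\<sigma> (ounit E) = ounit F" "?\<sigma>' (ounit F) = ounit E"
    using mor by (simp_all add: ea_morphism_def sharp_alg_def sub_ealg_def)
  have s_sum: "osum F (\<sigma> s) (\<sigma> t) = Some (\<sigma> r)"
    if "s \<in> sharp_elems E" "t \<in> sharp_elems E" "osum E s t = Some r" for s t r
    using mor(1) that E.sharp_osum[OF E.homogeneous that]
    by (auto simp: ea_morphism_def sharp_alg_def sub_ealg_def E.osum_on_Some F.osum_on_Some)
  have s_sum': "osum E (?\<sigma>' s) (?\<sigma>' t) = Some (?\<sigma>' r)"
    if "s \<in> sharp_elems F" "t \<in> sharp_elems F" "osum F s t = Some r" for s t r
    using mor(2) that F.sharp_osum[OF F.homogeneous that]
    by (auto simp: ea_morphism_def sharp_alg_def sub_ealg_def E.osum_on_Some F.osum_on_Some)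
  have m_sum: "osum (meager_alg F) (\<mu> m) (\<mu> n) = map_option \<mu> (osum (meager_alg E) m n)"
    if "m \<in> meager_elems E" "n \<in> meager_elems E" for m n
    using \<mu> that by (simp add: gea_isomorphism_def meager_alg_def)
  have m_sum1: "osum F (\<mu> m) (\<mu> n) = Some (\<mu> k)"
    if k: "osum E m n = Some k" "k \<in> meager_elems E" for m n k
  proof -
    have "m \<in> meager_elems E" "n \<in> meager_elems E" using E.meager_down[OF k(2)] E.ole_osum[OF k(1)] by blast+
    moreover have "osum (meager_alg E) m n = Some k" using k E.meager_sum_iff by simp
    ultimately have "osum (meager_alg F) (\<mu> m) (\<mu> n) = Some (\<mu> k)" using m_sum by simp
    then show ?thesis using F.meager_sum_iff by simp
  qed
  have m_sum2: "osum E (?\<mu>' m) (?\<mu>' n) = Some (?\<mu>' k)"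
    if k: "osum F m n = Some k" "k \<in> meager_elems F" for m n k
  proof -
    have M: "m \<in> meager_elems F" "n \<in> meager_elems F" using F.meager_down[OF k(2)] F.ole_osum[OF k(1)] by blast+
    have "osum (meager_alg F) m n = Some k" using k F.meager_sum_iff by simp
    \<comment> \<open>A defined \<open>map_option\<close> forces the sum in \<open>E\<close> to be
      defined; here the isomorphism of meager parts reflects definedness.\<close>
    then have "map_option \<mu> (osum (meager_alg E) (?\<mu>' m) (?\<mu>' n)) = Some k"
      using m_sum[OF m_img(2)[OF M(1)] m_img(2)[OF M(2)]] m_inv(2) M by simp
    then obtain j where j: "osum (meager_alg E) (?\<mu>' m) (?\<mu>' n) = Some j" "\<mu> j = k"
      by (auto simp only: map_option_eq_Some)
    then show ?thesis using E.meager_sum_iff m_inv(1) by metis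
  qed
  have le1: "ole F (\<mu> m) (\<sigma> s)" if "m \<in> meager_elems E" "s \<in> sharp_elems E" "ole E m s" for m s
    using h that by (auto simp: meager_below_def)
  have le2: "ole E (?\<mu>' m) (?\<sigma>' s)" if m: "m \<in> meager_elems F" "s \<in> sharp_elems F" "ole F m s" for m s
  proof -
    have "m \<in> meager_below F (\<sigma> (?\<sigma>' s))" using m s_inv(2) by (simp add: meager_below_def)
    then obtain n where "n \<in> meager_below E (?\<sigma>' s)" "m = \<mu> n" using h s_img(2)[OF m(2)] by blast
    then show ?thesis using m_inv(1) by (auto simp: meager_below_def)
  qed
  show ?thesis
    by unfold_locales (fact s_img s_sum s_sum' unit m_img m_sum1 m_sum2 le1 le2 s_inv m_inv)+
qed


theorem mainTheorem1:
  fixes E :: "'a ealg" and F :: "'b ealg"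
  assumes "trt_effect_algebra E" and "trt_effect_algebra F"
  shows "(\<exists>f. ea_isomorphism E F f) \<longleftrightarrow>
    (\<exists>\<sigma> \<mu>. ea_isomorphism (sharp_alg E) (sharp_alg F) \<sigma> \<and>
           gea_isomorphism (meager_alg E) (meager_alg F) \<mu> \<and>
           (\<forall>s\<in>sharp_elems E. \<mu> ` meager_below E s = meager_below F (\<sigma> s)))"
proof
  interpret E: trt_effect_algebra E by (rule assms(1))
  interpret F: trt_effect_algebra F by (rule assms(2))
  assume "\<exists>f. ea_isomorphism E F f"
  then obtain f where "ea_isomorphism E F f" ..
  then interpret ea_iso E F f by unfold_locales
  show "\<exists>\<sigma> \<mu>. ea_isomorphism (sharp_alg E) (sharp_alg F) \<sigma> \<and>
      gea_isomorphism (meager_alg E) (meager_alg F) \<mu> \<and>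
      (\<forall>s\<in>sharp_elems E. \<mu> ` meager_below E s = meager_below F (\<sigma> s))"
    \<comment> \<open>\<open>f\<close> itself serves as both maps; only the carriers shrink.\<close>
    using sharp_isomorphism meager_isomorphism meager_below_image
    by (intro exI[of _ f] conjI ballI)
next
  assume "\<exists>\<sigma> \<mu>. ea_isomorphism (sharp_alg E) (sharp_alg F) \<sigma> \<and>
      gea_isomorphism (meager_alg E) (meager_alg F) \<mu> \<and>
      (\<forall>s\<in>sharp_elems E. \<mu> ` meager_below E s = meager_below F (\<sigma> s))"
  then obtain \<sigma> \<mu> where "ea_isomorphism (sharp_alg E) (sharp_alg F) \<sigma>"
      "gea_isomorphism (meager_alg E) (meager_alg F) \<mu>"
      "\<forall>s\<in>sharp_elems E. \<mu> ` meager_below E s = meager_below F (\<sigma> s)" by blast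
  from triple_iso.glue_isomorphism[OF triple_isoI[OF assms this]]
  show "\<exists>f. ea_isomorphism E F f" by (intro exI)
qed

end
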